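(* Let $\mathcal{G}$ and $\mathcal{G}^*$ be two graph classes such that for every graph $G$ in $\mathcal{G}$ and every vertex $v$ of $G$ the graph $G-N[v]$ is in $\mathcal{G}^*$. Assume that for each graph $G$ in $\mathcal{G}^*$ with $n$ vertices and $m$ edges one can compute in time $f(n,m)$ a rational (resp. integer or unit) well-covering system of $G$ with size at most $g(n,m)$, where $f$ and $g$ are nondecreasing functions. Then for any graph $G$ in $\mathcal{G}$ with $n$ vertices and $m$ edges, one can compute in time $\mathcal{O}(n\cdot(n+m+f(n,m)))$ a rational (resp. integer or unit) well-covering system of $G$ with size at most $n\cdot g(n,m)+n-1$.
   Context: All graphs are finite, simple, and undirected. $N[v]$ denotes the closed neighborhood of $v$ in $G$, that is, $v$ together with all vertices adjacent to $v$; $G-N[v]$ is the graph obtained from $G$ by deleting all vertices in $N[v]$. An independent set is a set of pairwise nonadjacent vertices; it is maximal if it is not contained in any larger independent set. A weight function $w:V(G)\to\mathbb{R}$ is a well-covered weighting of $G$ if all maximal independent sets $I$ of $G$ have the same weight $w(I)=\sum_{v\in I}w(v)$. A well-covering system of $G$ is a system $\mathcal{S}$ of homogeneous linear equations with real coefficients over the variables $\{x_v: v\in V(G)\}$ such that $w:V(G)\to\mathbb{R}$ is a well-covered weighting of $G$ if and only if setting $x_v=w(v)$ for all $v\in V(G)$ satisfies all equations of $\mathcal{S}$. Its size $|\mathcal{S}|$ is its number of equations. It is rational (resp. integer, unit) if all its coefficients are rational (resp. integers, in $\{-1,0,1\}$). A function $f:\mathbb{R}^+\times\mathbb{R}^+\to\mathbb{R}^+$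 (with $\mathbb{R}^+$ the nonnegative reals) is nondecreasing if $0\le x_1\le x_2$ and $0\le y_1\le y_2$ imply $f(x_1,y_1)\le f(x_2,y_2)$. *)

theory Defs
  imports Complex_Main
begin

section \<open>Graphs and well-covered weightings\<close>

record 'a graph =
  verts :: "'a set"
  edges :: "'a set set"

definition finite_simple_graph :: "'a graph \<Rightarrow> bool" where
  "finite_simple_graph G \<longleftrightarrow> finite (verts G) \<and> (\<forall>e\<in>edges G. e \<subseteq> verts G \<and> card e = 2)"

definition closed_nbhd :: "'a graph \<Rightarrow> 'a \<Rightarrow> 'a set" where
  "closed_nbhd G v = insert v {u \<in> verts G. {u, v} \<in> edges G}"

definition delete_verts :: "'a graph \<Rightarrow> 'a set \<Rightarrow> 'a graph" where
  "delete_verts G X = \<lparr>verts = verts G - X, edges = {e \<in> edges G. e \<inter> X = {}}\<rparr>"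

definition independent_set :: "'a graph \<Rightarrow> 'a set \<Rightarrow> bool" where
  "independent_set G I \<longleftrightarrow> I \<subseteq> verts G \<and> (\<forall>u\<in>I. \<forall>v\<in>I. {u, v} \<notin> edges G)"

definition maximal_independent_set :: "'a graph \<Rightarrow> 'a set \<Rightarrow> bool" where
  "maximal_independent_set G I \<longleftrightarrow>
     independent_set G I \<and> \<not> (\<exists>J. independent_set G J \<and> I \<subset> J)"

text \<open>Weightings and coefficient vectors are total functions of which only the values on
  the vertices of the graph matter.\<close>

definition well_covered_weighting :: "'a graph \<Rightarrow> ('a \<Rightarrow> real) \<Rightarrow> bool" where
  "well_covered_weighting G w \<longleftrightarrow>
     (\<forall>I J. maximal_independent_set G I \<and> maximal_independent_set G J \<longrightarrow>
        (\<Sum>v\<in>I. w v) = (\<Sum>v\<in>J. w v))"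

text \<open>A homogeneous linear equation is given by its coefficients, and a system is a list of
  equations; its size is the length of the list.\<close>

definition well_covering_system :: "'a graph \<Rightarrow> ('a \<Rightarrow> real) list \<Rightarrow> bool" where
  "well_covering_system G S \<longleftrightarrow>
     (\<forall>w. well_covered_weighting G w \<longleftrightarrow> (\<forall>a\<in>set S. (\<Sum>v\<in>verts G. a v * w v) = 0))"

definition coefficients_in :: "real set \<Rightarrow> 'a graph \<Rightarrow> ('a \<Rightarrow> real) list \<Rightarrow> bool" where
  "coefficients_in C G S \<longleftrightarrow> (\<forall>a\<in>set S. \<forall>v\<in>verts G. a v \<in> C)"

text \<open>Functions from pairs of nonnegative reals to nonnegative reals, nondecreasing in the
  product order; the values elsewhere are irrelevant.\<close>

definition nondecreasing_nonneg :: "(real \<Rightarrow> real \<Rightarrow> real) \<Rightarrow> bool" where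
  "nondecreasing_nonneg f \<longleftrightarrow>
     (\<forall>x y. 0 \<le> x \<and> 0 \<le> y \<longrightarrow> 0 \<le> f x y) \<and>
     (\<forall>x1 x2 y1 y2. 0 \<le> x1 \<and> x1 \<le> x2 \<and> 0 \<le> y1 \<and> y1 \<le> y2 \<longrightarrow> f x1 y1 \<le> f x2 y2)"


section \<open>Model of computation\<close>

text \<open>A unit-cost random access machine over the integers, programmed in a structured
  language. The memory is divided into segments, of which a program uses the finitely many
  that it names; a register is a segment used at a single address. Inputs are found in
  memory, and outputs are printed to a write-only tape (the second component of a state).\<close>

type_synonym memory = "nat \<Rightarrow> int \<Rightarrow> int"

datatype expr =
    Const int
  | Load nat expr
  | Add expr expr
  | Sub expr expr
  | Mul expr expr
  | Div expr expr

primrec eval_expr :: "memory \<Rightarrow> expr \<Rightarrow> int" where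
  "eval_expr m (Const k) = k"
| "eval_expr m (Load s e) = m s (eval_expr m e)"
| "eval_expr m (Add d e) = eval_expr m d + eval_expr m e"
| "eval_expr m (Sub d e) = eval_expr m d - eval_expr m e"
| "eval_expr m (Mul d e) = eval_expr m d * eval_expr m e"
| "eval_expr m (Div d e) = eval_expr m d div eval_expr m e"

primrec expr_cost :: "expr \<Rightarrow> nat" where
  "expr_cost (Const k) = 1"
| "expr_cost (Load s e) = 1 + expr_cost e"
| "expr_cost (Add d e) = 1 + expr_cost d + expr_cost e"
| "expr_cost (Sub d e) = 1 + expr_cost d + expr_cost e"
| "expr_cost (Mul d e) = 1 + expr_cost d + expr_cost e"
| "expr_cost (Div d e) = 1 + expr_cost d + expr_cost e"

text \<open>Conditions are integer expressions, true when the value is positive.\<close>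

datatype prog =
    Skip
  | Store nat expr expr
  | Print expr
  | Seq prog prog
  | Cond expr prog prog
  | Loop expr prog

type_synonym state = "memory \<times> int list"

text \<open>\<open>exec p \<sigma> t \<tau>\<close>: started in \<open>\<sigma>\<close>, the program \<open>p\<close> halts in \<open>\<tau>\<close> after exactly \<open>t\<close> steps.\<close>

inductive exec :: "prog \<Rightarrow> state \<Rightarrow> nat \<Rightarrow> state \<Rightarrow> bool" where
  Skip: "exec Skip \<sigma> 1 \<sigma>"
| Store: "exec (Store s i e) (m, out) (1 + expr_cost i + expr_cost e)
     (m(s := (m s)(eval_expr m i := eval_expr m e)), out)"
| Print: "exec (Print e) (m, out) (1 + expr_cost e) (m, out @ [eval_expr m e])"
| Seq: "exec p \<sigma> t \<sigma>' \<Longrightarrow> exec q \<sigma>' t' \<sigma>'' \<Longrightarrow> exec (Seq p q) \<sigma> (t + t') \<sigma>''"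
| CondTrue: "eval_expr (fst \<sigma>) b > 0 \<Longrightarrow> exec p \<sigma> t \<sigma>' \<Longrightarrow>
     exec (Cond b p q) \<sigma> (1 + expr_cost b + t) \<sigma>'"
| CondFalse: "eval_expr (fst \<sigma>) b \<le> 0 \<Longrightarrow> exec q \<sigma> t \<sigma>' \<Longrightarrow>
     exec (Cond b p q) \<sigma> (1 + expr_cost b + t) \<sigma>'"
| LoopFalse: "eval_expr (fst \<sigma>) b \<le> 0 \<Longrightarrow> exec (Loop b p) \<sigma> (1 + expr_cost b) \<sigma>"
| LoopTrue: "eval_expr (fst \<sigma>) b > 0 \<Longrightarrow> exec p \<sigma> t \<sigma>' \<Longrightarrow> exec (Loop b p) \<sigma>' t' \<sigma>'' \<Longrightarrow>
     exec (Loop b p) \<sigma> (1 + expr_cost b + t + t') \<sigma>''"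

inductive_cases SkipE: "exec Skip \<sigma> t \<tau>"
inductive_cases StoreE: "exec (Store s i e) \<sigma> t \<tau>"
inductive_cases PrintE: "exec (Print e) \<sigma> t \<tau>"
inductive_cases SeqE: "exec (Seq p q) \<sigma> t \<tau>"
inductive_cases CondE: "exec (Cond b p q) \<sigma> t \<tau>"
inductive_cases LoopE: "exec (Loop b p) \<sigma> t \<tau>"

lemma exec_deterministic:
  "exec p \<sigma> t \<tau> \<Longrightarrow> exec p \<sigma> t' \<tau>' \<Longrightarrow> t' = t \<and> \<tau>' = \<tau>"
proof (induction arbitrary: t' \<tau>' rule: exec.induct)
  case (Seq p \<sigma> t1 \<sigma>1 q t2 \<sigma>2)
  from Seq.prems show ?case
  proof (rule SeqE)
    fix u \<rho> u'
    assume *: "t' = u + u'" "exec p \<sigma> u \<rho>" "exec q \<rho> u' \<tau>'"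
    have 1: "u = t1 \<and> \<rho> = \<sigma>1" by (rule Seq.IH(1)) (fact *)
    have "u' = t2 \<and> \<tau>' = \<sigma>2" by (rule Seq.IH(2)) (use * 1 in simp)
    with * 1 show ?thesis by simp
  qed
next
  case (LoopTrue \<sigma> b p t1 \<sigma>1 t2 \<sigma>2)
  from LoopTrue.prems show ?case
  proof (rule LoopE)
    assume "eval_expr (fst \<sigma>) b \<le> 0"
    with LoopTrue.hyps show ?thesis by simp
  next
    fix u \<rho> u'
    assume *: "t' = Suc (expr_cost b + u + u')" "exec p \<sigma> u \<rho>" "exec (Loop b p) \<rho> u' \<tau>'"
    have 1: "u = t1 \<and> \<rho> = \<sigma>1" by (rule LoopTrue.IH(1)) (fact *)
    have "u' = t2 \<and> \<tau>' = \<sigma>2" by (rule LoopTrue.IH(2)) (use * 1 in simp)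
    with * 1 show ?thesis by simp
  qed
next
  case (CondTrue \<sigma> b p t1 \<sigma>1 q)
  from CondTrue.prems show ?case by (rule CondE) (use CondTrue.hyps(1) in \<open>auto dest!: CondTrue.IH\<close>)
next
  case (CondFalse \<sigma> b q t1 \<sigma>1 p)
  from CondFalse.prems show ?case by (rule CondE) (use CondFalse.hyps(1) in \<open>auto dest!: CondFalse.IH\<close>)
next
  case (LoopFalse \<sigma> b p)
  from LoopFalse.prems show ?case by (rule LoopE) (use LoopFalse.hyps in auto)
qed (auto elim: SkipE StoreE PrintE)


section \<open>Representation of graphs and of systems of equations\<close>

text \<open>The vertices are numbered \<open>0, 1, \<dots>\<close> along an enumeration \<open>vs\<close>; a program only sees the
  numbers. Adjacency lists may list the neighbors in any order.\<close>

definition adjacency_lists :: "'a graph \<Rightarrow> 'a list \<Rightarrow> nat list list \<Rightarrow> bool" where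
  "adjacency_lists G vs As \<longleftrightarrow>
     distinct vs \<and> set vs = verts G \<and> length As = length vs \<and>
     (\<forall>i<length vs. distinct (As ! i) \<and>
        set (As ! i) = {j. j < length vs \<and> {vs ! i, vs ! j} \<in> edges G})"

text \<open>Segment 0 holds the number of vertices, segment 2 the concatenated adjacency lists, and
  segment 1 the position in segment 2 where each list begins (and the last one ends). All
  other memory cells have unspecified contents.\<close>

definition graph_in_memory :: "'a graph \<Rightarrow> 'a list \<Rightarrow> memory \<Rightarrow> bool" where
  "graph_in_memory G vs m \<longleftrightarrow>
     (\<exists>As. adjacency_lists G vs As \<and>
        m 0 0 = int (length vs) \<and>
        (\<forall>i\<le>length vs. m 1 (int i) = int (length (concat (take i As)))) \<and>
        (\<forall>k<length (concat As). m 2 (int k) = int (concat As ! k)))"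

text \<open>An equation is printed sparsely: the number of its terms, followed for each term by the
  number of its variable and the numerator and denominator of its coefficient. Variables that
  are not listed have coefficient 0.\<close>

type_synonym sparse_equation = "(nat \<times> int \<times> int) list"

definition valid_equation :: "nat \<Rightarrow> sparse_equation \<Rightarrow> bool" where
  "valid_equation n ts \<longleftrightarrow> distinct (map fst ts) \<and> (\<forall>(i, p, q)\<in>set ts. i < n \<and> q \<noteq> 0)"

definition equation_coeff :: "'a list \<Rightarrow> sparse_equation \<Rightarrow> 'a \<Rightarrow> real" where
  "equation_coeff vs ts v = (\<Sum>(i, p, q)\<leftarrow>ts. if vs ! i = v then real_of_int p / real_of_int q else 0)"

definition print_equation :: "sparse_equation \<Rightarrow> int list" where
  "print_equation ts = int (length ts) # concat (map (\<lambda>(i, p, q). [int i, p, q]) ts)"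

definition prints_system :: "'a list \<Rightarrow> int list \<Rightarrow> ('a \<Rightarrow> real) list \<Rightarrow> bool" where
  "prints_system vs out S \<longleftrightarrow>
     (\<exists>tss. (\<forall>ts\<in>set tss. valid_equation (length vs) ts) \<and>
        out = concat (map print_equation tss) \<and> S = map (equation_coeff vs) tss)"

text \<open>For each graph in the class, with \<open>n\<close> vertices and \<open>m\<close> edges, one can compute in time
  \<open>T n m\<close> a well-covering system with coefficients in \<open>C\<close> and of size at most \<open>B n m\<close>.\<close>

definition well_covering_computable ::
  "real set \<Rightarrow> 'a graph set \<Rightarrow> (real \<Rightarrow> real \<Rightarrow> real) \<Rightarrow> (real \<Rightarrow> real \<Rightarrow> real) \<Rightarrow> bool" where
  "well_covering_computable C \<G> T B \<longleftrightarrow>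
     (\<exists>p. \<forall>G\<in>\<G>. \<forall>vs mem. graph_in_memory G vs mem \<longrightarrow>
        (\<exists>t mem' out S. exec p (mem, []) t (mem', out) \<and>
           real t \<le> T (real (card (verts G))) (real (card (edges G))) \<and>
           prints_system vs out S \<and>
           well_covering_system G S \<and> coefficients_in C G S \<and>
           real (length S) \<le> B (real (card (verts G))) (real (card (edges G)))))"

end

theory Submission
  imports Defs
begin

text \<open>
  A maximal independent set of \<open>G\<close> containing \<open>v\<close> is \<open>v\<close> together with a maximal independent set of
  \<open>G - N[v]\<close>. Hence \<open>w\<close> is a well-covered weighting of \<open>G\<close> iff it is one of \<open>G - N[v]\<close> for every
  vertex \<open>v\<close> and, for a fixed vertex \<open>v\<^sub>0\<close> and every other vertex \<open>v\<close>, some maximal independent set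
  containing \<open>v\<close> has the same weight as some maximal independent set containing \<open>v\<^sub>0\<close>.
  For each \<open>v\<close> the algorithm constructs \<open>G - N[v]\<close>, runs the given program on it, translates the
  intercepted output back to the numbering of \<open>G\<close>, and then prints one equation comparing two greedily
  computed maximal independent sets. The running time of the given program also bounds the length of
  its output, hence the cost of the translation.
\<close>

section \<open>Running times of programs\<close>

text \<open>The cost model and the unspecified memory contents shape the construction. To reach
  \<open>n * (n + m + f n m)\<close>, the work around each call must be linear in
  \<open>n + m\<close>: a scan of neighbors is charged by the length of the list scanned, and the
  lists have total length \<open>L\<close>, at most twice the number of edges. Translation copies
  numerators and denominators, the vertices of N[v] get coefficient 0, and comparisons have
  coefficients -1, 0 and 1; hence the rational, integer and unit cases are handled at once through
  \<open>{-1, 0, 1} \<subseteq> C\<close>. The fixed vertex is the one numbered 0. Its block has no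
  comparison, which accounts for the -1 in the size bound. Time and correctness are proved together:
  the number of steps is an argument of the postcondition of \<open>runs\<close>.\<close>

definition runs :: "prog \<Rightarrow> memory \<Rightarrow> int list \<Rightarrow> (nat \<Rightarrow> memory \<Rightarrow> int list \<Rightarrow> bool) \<Rightarrow> bool" where
  "runs p m out Q \<longleftrightarrow> (\<exists>t m' out'. exec p (m, out) t (m', out') \<and> Q t m' out')"

lemma runs_mono:
  assumes "runs p m out Q" and "\<And>t m' out'. Q t m' out' \<Longrightarrow> R t m' out'"
  shows "runs p m out R"
  using assms unfolding runs_def by blast

text \<open>The rules up to \<open>runs_Cond\<close> are equivalences, by inversion of
  \<open>exec\<close>. As simp rules they execute loop-free code symbolically and add up its cost;
  loops need an invariant instead.\<close>

lemma runs_Skip [simp]: "runs Skip m out Q \<longleftrightarrow> Q 1 m out"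
  unfolding runs_def by (auto elim: SkipE intro: exec.Skip[simplified])

lemma runs_Store [simp]:
  "runs (Store s i e) m out Q \<longleftrightarrow> Q (1 + expr_cost i + expr_cost e)
     (m(s := (m s)(eval_expr m i := eval_expr m e))) out"
  unfolding runs_def by (auto elim!: StoreE intro: exec.Store[simplified])

lemma runs_Print [simp]:
  "runs (Print e) m out Q \<longleftrightarrow> Q (1 + expr_cost e) m (out @ [eval_expr m e])"
  unfolding runs_def by (auto elim!: PrintE intro: exec.Print[simplified])

lemma runs_Seq [simp]:
  "runs (Seq p q) m out Q \<longleftrightarrow>
     runs p m out (\<lambda>t m' out'. runs q m' out' (\<lambda>t'. Q (t + t')))"
  unfolding runs_def by (fastforce elim!: SeqE intro: exec.Seq)

lemma runs_Cond [simp]: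
  "runs (Cond b p q) m out Q \<longleftrightarrow>
     runs (if eval_expr m b > 0 then p else q) m out (\<lambda>t. Q (1 + expr_cost b + t))"
proof (cases "eval_expr m b > 0")
  case True
  then show ?thesis
    unfolding runs_def
    by (auto elim!: CondE) (use exec.CondTrue[of "(m, out)" b p] in fastforce)
next
  case False
  then show ?thesis
    unfolding runs_def
    by (auto elim!: CondE) (use exec.CondFalse[of "(m, out)" b q] in fastforce)
qed

text \<open>The invariant is indexed by the number of completed rounds, and \<open>N\<close> is the
  exact number of rounds, so termination needs no separate measure. The cost \<open>c i\<close> may
  depend on the round; this is what lets degrees sum to \<open>L\<close>. The guard is evaluated
  \<open>N + 1\<close> times.\<close>

lemma runs_Loop:
  assumes "Inv 0 m out"
    and step: "\<And>i m out. i < N \<Longrightarrow> Inv i m out \<Longrightarrow> eval_expr m b > 0 \<and>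
      runs body m out (\<lambda>t m' out'. t \<le> c i \<and> Inv (Suc i) m' out')"
    and stop: "\<And>m out. Inv N m out \<Longrightarrow> eval_expr m b \<le> 0"
  shows "runs (Loop b body) m out (\<lambda>t m' out'.
    t \<le> (\<Sum>i<N. c i) + (N + 1) * (1 + expr_cost b) \<and> Inv N m' out')"
proof -
  have "runs (Loop b body) m out (\<lambda>t m' out'.
      t \<le> (\<Sum>i=k..<N. c i) + (N - k + 1) * (1 + expr_cost b) \<and> Inv N m' out')"
    if "k \<le> N" "Inv k m out" for k m out
    using that
  proof (induction "N - k" arbitrary: k m out)
    case 0
    then have "eval_expr m b \<le> 0" using stop by simp
    with 0 show ?case
      unfolding runs_def by (fastforce intro: exec.LoopFalse)
  next
    case (Suc d)
    then have k: "k < N" by simp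
    from step[OF this Suc.prems(2)] obtain t m1 out1 where b: "eval_expr m b > 0"
      and 1: "exec body (m, out) t (m1, out1)" "t \<le> c k" "Inv (Suc k) m1 out1"
      unfolding runs_def by blast
    have "d = N - Suc k" "Suc k \<le> N" using Suc.hyps(2) k by auto
    from Suc.hyps(1)[OF this 1(3)] obtain t' m2 out2 where
      2: "exec (Loop b body) (m1, out1) t' (m2, out2)" "Inv N m2 out2"
        "t' \<le> (\<Sum>i=Suc k..<N. c i) + (N - Suc k + 1) * (1 + expr_cost b)"
      unfolding runs_def by blast
    have e: "exec (Loop b body) (m, out) (1 + expr_cost b + t + t') (m2, out2)"
      using exec.LoopTrue[of "(m, out)" b body t "(m1, out1)" t' "(m2, out2)"] b 1 2 by simp
    have "(\<Sum>i=k..<N. c i) = c k + (\<Sum>i=Suc k..<N. c i)"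
      using k by (simp add: sum.atLeast_Suc_lessThan)
    moreover have "N - k = Suc (N - Suc k)" using k by simp
    ultimately have "1 + expr_cost b + t + t'
        \<le> (\<Sum>i=k..<N. c i) + (N - k + 1) * (1 + expr_cost b)"
      using 1 2 by simp
    with e 2 show ?case unfolding runs_def by blast
  qed
  from this[of 0] assms(1) show ?thesis by (simp add: atLeast0LessThan)
qed

abbreviation reg :: "nat \<Rightarrow> expr" where
  "reg r \<equiv> Load r (Const 0)"

abbreviation incr :: "nat \<Rightarrow> prog" where
  "incr r \<equiv> Store r (Const 0) (Add (reg r) (Const 1))"

definition For :: "nat \<Rightarrow> expr \<Rightarrow> expr \<Rightarrow> prog \<Rightarrow> prog" where
  "For r lo hi body = Seq (Store r (Const 0) lo) (Loop (Sub hi (reg r)) (Seq body (incr r)))"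

text \<open>The upper bound is re-evaluated in every round, so the invariant must fix its value, and
  the body must leave the counter alone. The 20 generously covers the counter update (6 steps), the
  guard and the initial assignment.\<close>

lemma runs_For:
  assumes lo: "eval_expr m lo = a"
    and init: "Inv 0 (m(r := (m r)(0 := a))) out"
    and step: "\<And>i m out. i < N \<Longrightarrow> Inv i m out \<Longrightarrow> m r 0 = a + int i \<Longrightarrow>
      runs body m out (\<lambda>t m' out'. t \<le> c i \<and> m' r 0 = a + int i \<and>
        Inv (Suc i) (m'(r := (m' r)(0 := a + int i + 1))) out')"
    and hi: "\<And>i m out. i \<le> N \<Longrightarrow> Inv i m out \<Longrightarrow> eval_expr m hi = a + int N"
  shows "runs (For r lo hi body) m out (\<lambda>t m' out'.
    t \<le> (\<Sum>i<N. c i) + (N + 1) * (expr_cost lo + expr_cost hi + 20) \<and> Inv N m' out')"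
proof -
  let ?Inv = "\<lambda>i m out. Inv i m out \<and> m r 0 = a + int i"
  have "runs (Loop (Sub hi (reg r)) (Seq body (incr r))) (m(r := (m r)(0 := a))) out
      (\<lambda>t m' out'. t \<le> (\<Sum>i<N. c i + 6) + (N + 1) * (1 + expr_cost (Sub hi (reg r)))
        \<and> ?Inv N m' out')"
  proof (rule runs_Loop)
    show "?Inv 0 (m(r := (m r)(0 := a))) out" using init by simp
  next
    fix i m out assume i: "i < N" and I: "?Inv i m out"
    have "runs (Seq body (incr r)) m out (\<lambda>t m' out'. t \<le> c i + 6 \<and> ?Inv (Suc i) m' out')"
      unfolding runs_Seq
      by (rule runs_mono[OF step[OF i]]) (use I in \<open>auto simp: algebra_simps\<close>)
    moreover have "eval_expr m (Sub hi (reg r)) > 0" using hi[of i m out] i I by simp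
    ultimately show "eval_expr m (Sub hi (reg r)) > 0 \<and>
      runs (Seq body (incr r)) m out (\<lambda>t m' out'. t \<le> c i + 6 \<and> ?Inv (Suc i) m' out')" by blast
  next
    fix m out assume "?Inv N m out"
    then show "eval_expr m (Sub hi (reg r)) \<le> 0" using hi[of N m out] by simp
  qed
  then show ?thesis
    unfolding For_def runs_Seq runs_Store eval_expr.simps lo
    by (rule runs_mono) (auto simp: sum.distrib algebra_simps)
qed

definition arr :: "(int \<Rightarrow> int) \<Rightarrow> int list \<Rightarrow> bool" where
  "arr f xs \<longleftrightarrow> (\<forall>k<length xs. f (int k) = xs ! k)"

lemma arr_Nil [simp]: "arr f []"
  by (simp add: arr_def)

lemma arr_snoc: "arr f xs \<Longrightarrow> l = int (length xs) \<Longrightarrow> arr (f(l := x)) (xs @ [x])"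
  by (auto simp: arr_def nth_append)

lemma arr_append: "arr f (xs @ ys) \<Longrightarrow> k < length ys \<Longrightarrow> f (int (length xs) + int k) = ys ! k"
  unfolding arr_def by (metis length_append nat_add_left_cancel_less nth_append_length_plus of_nat_add)

definition same :: "nat set \<Rightarrow> memory \<Rightarrow> memory \<Rightarrow> bool" where
  "same X m m' \<longleftrightarrow> (\<forall>s. s \<notin> X \<longrightarrow> m' s = m s)"


section \<open>Running a program as a subroutine\<close>

text \<open>Segment numbers are literals in the program text, so adding 20 moves the whole memory of
  a program clear of the segments 0 to 17 used around it, at no cost; addresses stay as they
  are.\<close>

primrec shift_expr :: "expr \<Rightarrow> expr" where
  "shift_expr (Const k) = Const k"
| "shift_expr (Load s e) = Load (s + 20) (shift_expr e)"
| "shift_expr (Add d e) = Add (shift_expr d) (shift_expr e)"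
| "shift_expr (Sub d e) = Sub (shift_expr d) (shift_expr e)"
| "shift_expr (Mul d e) = Mul (shift_expr d) (shift_expr e)"
| "shift_expr (Div d e) = Div (shift_expr d) (shift_expr e)"

text \<open>A program that is run as a subroutine must not write to the output tape.\<close>
primrec shift_prog :: "prog \<Rightarrow> prog" where
  "shift_prog Skip = Skip"
| "shift_prog (Store s i e) = Store (s + 20) (shift_expr i) (shift_expr e)"
| "shift_prog (Print e) = Seq (Store 6 (reg 7) (shift_expr e)) (incr 7)"
| "shift_prog (Seq p q) = Seq (shift_prog p) (shift_prog q)"
| "shift_prog (Cond b p q) = Cond (shift_expr b) (shift_prog p) (shift_prog q)"
| "shift_prog (Loop b p) = Loop (shift_expr b) (shift_prog p)"

definition sim :: "state \<Rightarrow> memory \<Rightarrow> bool" where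
  "sim \<sigma> M \<longleftrightarrow> fst \<sigma> = (\<lambda>s. M (s + 20)) \<and> M 7 0 = int (length (snd \<sigma>)) \<and> arr (M 6) (snd \<sigma>)"

lemma eval_shift_expr [simp]: "eval_expr M (shift_expr e) = eval_expr (\<lambda>s. M (s + 20)) e"
  by (induction e) auto

lemma expr_cost_shift_expr [simp]: "expr_cost (shift_expr e) = expr_cost e"
  by (induction e) auto

text \<open>Induction on the given run, so that loops need no invariant. Only \<open>Print\<close>
  becomes slower: storing into the buffer and incrementing its length turn cost \<open>1 + c\<close>
  into \<open>9 + c\<close>, where \<open>c\<close> is the cost of the expression; hence the factor
  9.\<close>

lemma exec_shift_prog:
  assumes "exec p \<sigma> t \<tau>" and "sim \<sigma> M"
  shows "runs (shift_prog p) M out (\<lambda>t' M' out'. t' \<le> 9 * t \<and> out' = out \<and> sim \<tau> M' \<and>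
    same ({6, 7} \<union> {20..}) M M')"
  using assms
proof (induction arbitrary: M rule: exec.induct)
  case (Skip \<sigma>)
  then show ?case by (simp add: same_def)
next
  case (Store s i e m out)
  then have "m = (\<lambda>s. M (s + 20))" by (simp add: sim_def)
  with Store show ?case by (auto simp: same_def sim_def)
next
  case (Print e m out)
  then have "m = (\<lambda>s. M (s + 20))" by (simp add: sim_def)
  with Print show ?case by (auto simp: same_def sim_def arr_snoc)
next
  case (Seq p \<sigma> t \<sigma>' q t' \<sigma>'')
  show ?case
    unfolding shift_prog.simps runs_Seq
    apply (rule runs_mono[OF Seq.IH(1)[OF Seq.prems]])
    apply clarify
    subgoal for s M1
      by (rule runs_mono[OF Seq.IH(2)]) (auto simp: same_def)
    done
next
  case (CondTrue \<sigma> b p t \<sigma>' q)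
  have "eval_expr M (shift_expr b) > 0" using CondTrue by (simp add: sim_def)
  then show ?case
    unfolding shift_prog.simps runs_Cond
    by simp (rule runs_mono[OF CondTrue.IH[OF CondTrue.prems]], auto)
next
  case (CondFalse \<sigma> b q t \<sigma>' p)
  have "\<not> eval_expr M (shift_expr b) > 0" using CondFalse by (simp add: sim_def)
  then show ?case
    unfolding shift_prog.simps runs_Cond
    by simp (rule runs_mono[OF CondFalse.IH[OF CondFalse.prems]], auto)
next
  case (LoopFalse \<sigma> b p)
  have "exec (Loop (shift_expr b) (shift_prog p)) (M, out) (1 + expr_cost b) (M, out)"
    using exec.LoopFalse[of "(M, out)" "shift_expr b"] LoopFalse by (simp add: sim_def)
  with LoopFalse show ?case unfolding runs_def shift_prog.simps
    by (intro exI[of _ "1 + expr_cost b"] exI[of _ M] exI[of _ out]) (simp add: same_def)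
next
  case (LoopTrue \<sigma> b p t \<sigma>' t' \<sigma>'')
  from LoopTrue.IH(1)[OF LoopTrue.prems] obtain s M1 where 1:
    "exec (shift_prog p) (M, out) s (M1, out)" "s \<le> 9 * t" "sim \<sigma>' M1" "same ({6, 7} \<union> {20..}) M M1"
    unfolding runs_def by blast
  from LoopTrue.IH(2)[OF 1(3)] obtain s' M2 where 2:
    "exec (Loop (shift_expr b) (shift_prog p)) (M1, out) s' (M2, out)" "s' \<le> 9 * t'"
    "sim \<sigma>'' M2" "same ({6, 7} \<union> {20..}) M1 M2"
    unfolding runs_def by auto
  have "exec (Loop (shift_expr b) (shift_prog p)) (M, out) (1 + expr_cost b + s + s') (M2, out)"
    using exec.LoopTrue[of "(M, out)" "shift_expr b" _ s "(M1, out)" s' "(M2, out)"] 1 2 LoopTrue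
    by (simp add: sim_def)
  with 1 2 show ?case unfolding runs_def shift_prog.simps
    by (intro exI[of _ "1 + expr_cost b + s + s'"] exI[of _ M2] exI[of _ out]) (simp add: same_def)
qed

lemma exec_length_output: "exec p \<sigma> t \<tau> \<Longrightarrow> length (snd \<tau>) \<le> length (snd \<sigma>) + t"
  by (induction rule: exec.induct) auto


section \<open>Construction of the vertex-deleted subgraphs\<close>

text \<open>
  Memory layout: segments 0 to 2 hold the input graph, and the copy of the given program that
  works on \<open>G - N[v]\<close> lives in the segments from 20 on, so its input is built in segments 20 to 22.
  Segment 3 marks \<open>N[v]\<close>; 4 and 5 translate old vertex numbers to new ones and back; 6 is the
  buffer for intercepted output and 7 its length; 8 and 9 hold indicator vectors of maximal
  independent sets; 10 holds \<open>v\<close>; 11 to 17 are loop counters and scratch registers.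
\<close>

definition Nbrs :: "nat \<Rightarrow> expr \<Rightarrow> prog \<Rightarrow> prog" where
  "Nbrs r e body = For r (Load 1 e) (Load 1 (Add e (Const 1))) body"

definition mark :: prog where
  "mark = Seq (For 11 (Const 0) (reg 0) (Store 3 (reg 11) (Const 0)))
     (Seq (Store 3 (reg 10) (Const 1)) (Nbrs 12 (reg 10) (Store 3 (Load 2 (reg 12)) (Const 1))))"

definition push :: "nat \<Rightarrow> nat \<Rightarrow> expr \<Rightarrow> prog" where
  "push s r e = Seq (Store s (reg r) e) (incr r)"

definition renumber :: prog where
  "renumber = Seq (Store 13 (Const 0) (Const 0)) (For 11 (Const 0) (reg 0)
     (Cond (Load 3 (reg 11)) Skip (Seq (Store 4 (reg 11) (reg 13)) (push 5 13 (reg 11)))))"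

definition build :: prog where
  "build = Seq (Store 14 (Const 0) (Const 0))
    (Seq (For 11 (Const 0) (reg 13)
      (Seq (Store 21 (reg 11) (reg 14))
        (Nbrs 12 (Load 5 (reg 11)) (Cond (Load 3 (Load 2 (reg 12))) Skip
          (push 22 14 (Load 4 (Load 2 (reg 12))))))))
    (Seq (Store 21 (reg 13) (reg 14)) (Store 20 (Const 0) (reg 13))))"

definition greedy :: "nat \<Rightarrow> expr \<Rightarrow> prog" where
  "greedy s e = Seq (For 11 (Const 0) (reg 0) (Store s (reg 11) (Const 0)))
    (Seq (Store s e (Const 1))
    (For 11 (Const 0) (reg 0) (Seq (Store 15 (Const 0) (Const 0))
      (Seq (Nbrs 12 (reg 11) (Store 15 (Const 0) (Add (reg 15) (Load s (Load 2 (reg 12))))))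
      (Cond (reg 15) Skip (Store s (reg 11) (Const 1)))))))"

section \<open>Neighbor lists over vertex numbers, without reference to a graph\<close>

locale adjacency =
  fixes As :: "nat list list"
  assumes range: "i < length As \<Longrightarrow> j \<in> set (As ! i) \<Longrightarrow> j < length As"
    and sym: "i < length As \<Longrightarrow> j \<in> set (As ! i) \<Longrightarrow> i \<in> set (As ! j)"
    and irrefl: "i < length As \<Longrightarrow> i \<notin> set (As ! i)"
begin

abbreviation n :: nat where "n \<equiv> length As"
abbreviation L :: nat where "L \<equiv> length (concat As)"

definition off :: "nat \<Rightarrow> nat" where
  "off i = length (concat (take i As))"

lemma off_Suc: "i < n \<Longrightarrow> off (Suc i) = off i + length (As ! i)"
  by (simp add: off_def take_Suc_conv_app_nth)

lemma concat_split: "i < n \<Longrightarrow> concat As = concat (take i As) @ As ! i @ concat (drop (Suc i) As)"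
  by (metis append.assoc concat.simps(2) concat_append id_take_nth_drop)

lemma length_nbrs_le: "i < n \<Longrightarrow> length (As ! i) \<le> L"
  by (subst concat_split[of i]) auto

lemma sum_length_nbrs: "(\<Sum>i<n. length (As ! i)) = L"
  by (simp add: length_concat sum_list_sum_nth atLeast0LessThan)

definition graph_mem :: "memory \<Rightarrow> bool" where
  "graph_mem m \<longleftrightarrow> m 0 0 = int n \<and> (\<forall>i\<le>n. m 1 (int i) = int (off i)) \<and>
     (\<forall>k<L. m 2 (int k) = int (concat As ! k))"

lemma graph_mem_nbr:
  assumes "graph_mem m" "i < n" "k < length (As ! i)"
  shows "m 2 (int (off i) + int k) = int (As ! i ! k)"
proof -
  have c: "concat As = concat (take i As) @ As ! i @ concat (drop (Suc i) As)"
    using assms concat_split by blast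
  have "off i + k < L" "concat As ! (off i + k) = As ! i ! k"
    using assms(3) by (subst c; simp add: off_def nth_append)+
  then show ?thesis using assms(1) unfolding graph_mem_def by (metis of_nat_add)
qed

lemma graph_mem_same:
  "same X m m' \<Longrightarrow> {0, 1, 2} \<inter> X = {} \<Longrightarrow> graph_mem m' \<longleftrightarrow> graph_mem m"
  by (simp add: same_def graph_mem_def)

text \<open>The counter runs over positions in segment 2, and the body receives the neighbor as the
  cell at that position. Both ends of the list come from segment 1, whose entry at \<open>n\<close>
  closes the last list. The end is read anew in each round, hence the demand that the invariant
  preserve the graph and the value of \<open>e\<close>.\<close>

lemma runs_Nbrs:
  assumes G: "graph_mem m" "eval_expr m e = int i" and i: "i < n"
    and init: "Inv 0 (m(r := (m r)(0 := int (off i)))) out"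
    and step: "\<And>k m out. k < length (As ! i) \<Longrightarrow> Inv k m out \<Longrightarrow>
      m 2 (m r 0) = int (As ! i ! k) \<Longrightarrow>
      runs body m out (\<lambda>t m' out'. t \<le> c \<and> m' r 0 = m r 0 \<and>
        Inv (Suc k) (m'(r := (m' r)(0 := m r 0 + 1))) out')"
    and inv: "\<And>k m out. Inv k m out \<Longrightarrow> graph_mem m \<and> eval_expr m e = int i"
  shows "runs (Nbrs r e body) m out (\<lambda>t m' out'.
    t \<le> (length (As ! i) + 1) * (c + 2 * expr_cost e + 30) \<and> Inv (length (As ! i)) m' out')"
proof -
  have off1: "m 1 (int i + 1) = int (off i) + int (length (As ! i))" if "graph_mem m" for m
  proof -
    have "m 1 (int (Suc i)) = int (off (Suc i))"
      using that i unfolding graph_mem_def by (metis Suc_leI)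
    then show ?thesis using off_Suc[OF i] by (simp add: add.commute)
  qed
  have "runs (For r (Load 1 e) (Load 1 (Add e (Const 1))) body) m out
    (\<lambda>t m' out'. t \<le> (\<Sum>k<length (As ! i). c) + (length (As ! i) + 1) *
      (expr_cost (Load 1 e) + expr_cost (Load 1 (Add e (Const 1))) + 20) \<and>
      Inv (length (As ! i)) m' out')"
  proof (rule runs_For)
    show "eval_expr m (Load 1 e) = int (off i)"
      using G i by (simp add: graph_mem_def)
  next
    fix k m out assume *: "k < length (As ! i)" "Inv k m out" "m r 0 = int (off i) + int k"
    show "runs body m out (\<lambda>t m' out'. t \<le> c \<and> m' r 0 = int (off i) + int k \<and>
      Inv (Suc k) (m'(r := (m' r)(0 := int (off i) + int k + 1))) out')"
      by (rule runs_mono[OF step[OF *(1,2)]])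
        (use * inv[OF *(2)] graph_mem_nbr[of m i k] i in auto)
  next
    fix k m out assume "Inv k m out"
    then show "eval_expr m (Load 1 (Add e (Const 1))) = int (off i) + int (length (As ! i))"
      using inv off1 by auto
  qed (rule init)
  then show ?thesis
    unfolding Nbrs_def by (rule runs_mono) (auto simp: algebra_simps)
qed

definition kept :: "nat \<Rightarrow> nat \<Rightarrow> bool" where
  "kept v j \<longleftrightarrow> j \<noteq> v \<and> j \<notin> set (As ! v)"

lemma runs_mark:
  assumes G: "graph_mem m" and v: "m 10 0 = int v" "v < n"
  shows "runs mark m out (\<lambda>t m' out'. t \<le> 100 * (n + L + 1) \<and> out' = out \<and>
    same {3, 11, 12} m m' \<and> (\<forall>j<n. m' 3 (int j) = of_bool (\<not> kept v j)))"
proof -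
  let ?I1 = "\<lambda>i m' out'. out' = out \<and> same {3, 11} m m' \<and> (\<forall>j<i. m' 3 (int j) = 0)"
  have 1: "runs (For 11 (Const 0) (reg 0) (Store 3 (reg 11) (Const 0))) m out
    (\<lambda>t m' out'. t \<le> (\<Sum>i<n. 4) + (n + 1) * (expr_cost (Const 0) + expr_cost (reg 0) + 20) \<and>
      ?I1 n m' out')"
    using G by (intro runs_For[where a = 0]) (auto simp: same_def graph_mem_def less_Suc_eq)
  let ?I2 = "\<lambda>k m' out'. out' = out \<and> same {3, 11, 12} m m' \<and>
    (\<forall>j<n. m' 3 (int j) = of_bool (j = v \<or> j \<in> set (take k (As ! v))))"
  have 2: "runs (Nbrs 12 (reg 10) (Store 3 (Load 2 (reg 12)) (Const 1))) m1 out
    (\<lambda>t m' out'. t \<le> (length (As ! v) + 1) * (5 + 2 * expr_cost (reg 10) + 30) \<and>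
      ?I2 (length (As ! v)) m' out')"
    if "same {3, 11} m m1" "\<forall>j<n. m1 3 (int j) = of_bool (j = v)" for m1
  proof (rule runs_Nbrs[OF _ _ v(2)])
    show "graph_mem m1" using G graph_mem_same[OF that(1)] by simp
  next
    fix k m' out' assume "?I2 k m' out'"
    then show "graph_mem m' \<and> eval_expr m' (reg 10) = int v"
      using G v graph_mem_same[of "{3, 11, 12}" m m'] by (auto simp: same_def)
  next
    fix k m' out' assume "k < length (As ! v)" "?I2 k m' out'" "m' 2 (m' 12 0) = int (As ! v ! k)"
    then show "runs (Store 3 (Load 2 (reg 12)) (Const 1)) m' out'
       (\<lambda>t m'' out''. t \<le> 5 \<and> m'' 12 0 = m' 12 0 \<and>
         ?I2 (Suc k) (m''(12 := (m'' 12)(0 := m' 12 0 + 1))) out'')"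
      by (auto simp: same_def take_Suc_conv_app_nth)
  qed (use that v in \<open>auto simp: same_def\<close>)
  show ?thesis
    unfolding mark_def runs_Seq
    apply (rule runs_mono[OF 1])
    apply clarsimp
    apply (rule runs_mono[OF 2])
    using v length_nbrs_le[OF v(2)] by (auto simp: same_def kept_def)
qed

definition old :: "nat \<Rightarrow> nat list" where
  "old v = filter (kept v) [0..<n]"

text \<open>The rank of \<open>j\<close> among the kept numbers; on kept numbers it is inverse to
  indexing into \<open>old v\<close>.\<close>

definition new :: "nat \<Rightarrow> nat \<Rightarrow> nat" where
  "new v j = length (filter (kept v) [0..<j])"

lemma runs_renumber:
  assumes G: "graph_mem m" and M: "\<forall>j<n. m 3 (int j) = of_bool (\<not> kept v j)"
  shows "runs renumber m out (\<lambda>t m' out'. t \<le> 100 * (n + 1) \<and> out' = out \<and>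
    same {4, 5, 11, 13} m m' \<and> m' 13 0 = int (length (old v)) \<and> arr (m' 5) (map int (old v)) \<and>
    (\<forall>j<n. kept v j \<longrightarrow> m' 4 (int j) = int (new v j)))"
proof -
  let ?f = "\<lambda>i. filter (kept v) [0..<i]"
  let ?I = "\<lambda>i m' out'. out' = out \<and> same {4, 5, 11, 13} m m' \<and> m' 13 0 = int (length (?f i)) \<and>
    arr (m' 5) (map int (?f i)) \<and> (\<forall>j<i. kept v j \<longrightarrow> m' 4 (int j) = int (new v j))"
  let ?b = "Cond (Load 3 (reg 11)) Skip (Seq (Store 4 (reg 11) (reg 13)) (push 5 13 (reg 11)))"
  have 1: "runs (For 11 (Const 0) (reg 0) ?b) m1 out
    (\<lambda>t m' out'. t \<le> (\<Sum>i<n. 40) + (n + 1) * (expr_cost (Const 0) + expr_cost (reg 0) + 20) \<and>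
      ?I n m' out')" if "same {13} m m1" "m1 13 0 = 0" for m1
  proof (rule runs_For[where a = 0])
    fix i m' out' assume *: "i < n" "?I i m' out'" "m' 11 0 = 0 + int i"
    have "m' 3 (int i) = of_bool (\<not> kept v i)" using M * by (auto simp: same_def)
    then show "runs ?b m' out' (\<lambda>t m'' out''. t \<le> 40 \<and> m'' 11 0 = 0 + int i \<and>
         ?I (Suc i) (m''(11 := (m'' 11)(0 := 0 + int i + 1))) out'')"
      using * by (cases "kept v i") (auto simp: same_def push_def arr_snoc less_Suc_eq new_def)
  qed (use that G in \<open>auto simp: same_def graph_mem_def\<close>)
  show ?thesis
    unfolding renumber_def runs_Seq runs_Store
    by (rule runs_mono[OF 1]) (auto simp: same_def old_def)
qed

lemma nth_old_new:
  assumes "kept v j" "j < n"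
  shows "new v j < length (old v)" "old v ! new v j = j"
proof -
  have "[0..<n] = [0..<j] @ j # [Suc j..<n]"
    using upt_add_eq_append[of 0 j "n - j"] upt_conv_Cons[of j n] assms(2) by simp
  then show "new v j < length (old v)" "old v ! new v j = j"
    using assms(1) by (simp_all add: old_def new_def)
qed

lemma distinct_old: "distinct (old v)"
  by (simp add: old_def)

lemma nth_old:
  assumes "a < length (old v)"
  shows "old v ! a < n" "kept v (old v ! a)"
  using nth_mem[OF assms] by (auto simp: old_def)

lemma new_nth_old: "a < length (old v) \<Longrightarrow> new v (old v ! a) = a"
  using nth_old nth_old_new distinct_old by (metis nth_eq_iff_index_eq)

definition sub_lists :: "nat \<Rightarrow> nat list list" where
  "sub_lists v = map (\<lambda>i. map (new v) (filter (kept v) (As ! i))) (old v)"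

text \<open>Construction of the subgraph scans the full lists of the kept vertices, deleted
  neighbors included, so its cost is governed by degrees in the original graph.\<close>

lemma sum_length_old_le: "(\<Sum>a<length (old v). length (As ! (old v ! a))) \<le> L"
proof -
  have "(\<Sum>a<length (old v). length (As ! (old v ! a))) = (\<Sum>i\<leftarrow>old v. length (As ! i))"
    by (simp add: sum_list_sum_nth atLeast0LessThan)
  also have "\<dots> \<le> (\<Sum>i\<leftarrow>[0..<n]. length (As ! i))"
    unfolding old_def by (rule sum_list_filter_le_nat)
  also have "\<dots> = L"
    unfolding sum_length_nbrs[symmetric] by (simp add: sum_list_sum_nth atLeast0LessThan)
  finally show ?thesis .
qed

lemma runs_build:
  assumes G: "graph_mem m" and M: "\<forall>j<n. m 3 (int j) = of_bool (\<not> kept v j)"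
    and old: "m 13 0 = int (length (old v))" "arr (m 5) (map int (old v))"
    and new: "\<forall>j<n. kept v j \<longrightarrow> m 4 (int j) = int (new v j)"
  shows "runs build m out (\<lambda>t m' out'. t \<le> 200 * (n + L + 1) \<and> out' = out \<and>
    same {11, 12, 14, 20, 21, 22} m m' \<and> m' 20 0 = int (length (old v)) \<and>
    (\<forall>a\<le>length (old v). m' 21 (int a) = int (length (concat (take a (sub_lists v))))) \<and>
    arr (m' 22) (map int (concat (sub_lists v))))"
proof -
  let ?B = "sub_lists v"
  let ?x = "\<lambda>a. concat (take a ?B)"
  let ?S = "same {11, 12, 14, 20, 21, 22}"
  let ?J = "\<lambda>m' xs. m' 14 0 = int (length xs) \<and> arr (m' 22) (map int xs)"
  let ?I = "\<lambda>a m' out'. out' = out \<and> ?S m m' \<and> ?J m' (?x a) \<and>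
    (\<forall>b<a. m' 21 (int b) = int (length (?x b)))"
  let ?bi = "Cond (Load 3 (Load 2 (reg 12))) Skip (push 22 14 (Load 4 (Load 2 (reg 12))))"
  let ?bo = "Seq (Store 21 (reg 11) (reg 14)) (Nbrs 12 (Load 5 (reg 11)) ?bi)"
  have inner: "runs (Nbrs 12 (Load 5 (reg 11)) ?bi) m1 out
    (\<lambda>t m' out'. t \<le> (length (As ! i) + 1) * (40 + 2 * expr_cost (Load 5 (reg 11)) + 30) \<and>
      out' = out \<and> same {12, 14, 22} m1 m' \<and>
      ?J m' (xs @ map (new v) (filter (kept v) (take (length (As ! i)) (As ! i)))))"
    if m1: "?S m m1" "?J m1 xs" and a: "a < length (old v)" "m1 11 0 = int a" "i = old v ! a"
    for m1 xs a i
  proof (rule runs_Nbrs)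
    have *: "graph_mem m' \<and> m' 3 = m 3 \<and> m' 4 = m 4 \<and> eval_expr m' (Load 5 (reg 11)) = int i"
      if "same {12, 14, 22} m1 m'" for m'
    proof -
      have s: "?S m m'" using m1(1) that by (auto simp: same_def)
      then have "graph_mem m'" using G graph_mem_same[OF s] by simp
      moreover have "m 5 (int a) = int i" using old(2) a by (simp add: arr_def)
      ultimately show ?thesis using s that a by (simp add: same_def)
    qed
    from *[of m1] show "graph_mem m1" "eval_expr m1 (Load 5 (reg 11)) = int i"
      by (simp_all add: same_def)
    show i: "i < n" using a nth_old by simp
    fix k m' out'
    assume I: "out' = out \<and> same {12, 14, 22} m1 m' \<and>
      ?J m' (xs @ map (new v) (filter (kept v) (take k (As ! i))))"
    then show "graph_mem m' \<and> eval_expr m' (Load 5 (reg 11)) = int i" using * by blast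
    assume k: "k < length (As ! i)" and r: "m' 2 (m' 12 0) = int (As ! i ! k)"
    let ?j = "As ! i ! k"
    have j: "?j < n" using range[OF i] k by simp
    then have "m' 3 (int ?j) = of_bool (\<not> kept v ?j)" "kept v ?j \<Longrightarrow> m' 4 (int ?j) = int (new v ?j)"
      using * I M new by auto
    then show "runs ?bi m' out' (\<lambda>t m'' out''. t \<le> 40 \<and> m'' 12 0 = m' 12 0 \<and>
        out'' = out \<and> same {12, 14, 22} m1 (m''(12 := (m'' 12)(0 := m' 12 0 + 1))) \<and>
        ?J (m''(12 := (m'' 12)(0 := m' 12 0 + 1)))
          (xs @ map (new v) (filter (kept v) (take (Suc k) (As ! i)))))"
      using I k r
      by (cases "kept v ?j")
        (auto simp: same_def push_def take_Suc_conv_app_nth arr_snoc simp flip: append_assoc)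
  qed (use m1 in \<open>auto simp: same_def\<close>)
  have outer: "runs (For 11 (Const 0) (reg 13) ?bo) m1 out
    (\<lambda>t m' out'. t \<le> (\<Sum>a<length (old v). 90 * (length (As ! (old v ! a)) + 1)) +
        (length (old v) + 1) * (expr_cost (Const 0) + expr_cost (reg 13) + 20) \<and>
      ?I (length (old v)) m' out')" if "same {14} m m1" "m1 14 0 = 0" for m1
  proof (rule runs_For[where a = 0])
    fix a m' out' assume *: "a < length (old v)" "?I a m' out'" "m' 11 0 = 0 + int a"
    have x: "?x (Suc a) = ?x a @ map (new v) (filter (kept v) (As ! (old v ! a)))"
      using *(1) by (simp add: take_Suc_conv_app_nth sub_lists_def)
    show "runs ?bo m' out' (\<lambda>t m'' out''. t \<le> 90 * (length (As ! (old v ! a)) + 1) \<and>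
        m'' 11 0 = 0 + int a \<and> ?I (Suc a) (m''(11 := (m'' 11)(0 := 0 + int a + 1))) out'')"
      unfolding runs_Seq runs_Store
      apply (simp only: *(2)[THEN conjunct1])
      apply (rule runs_mono[OF inner[of _ "?x a" a, OF _ _ _ _ refl]])
      using * by (auto simp: same_def x less_Suc_eq)
  qed (use that old G in \<open>auto simp: same_def\<close>)
  have len: "length (old v) \<le> n" unfolding old_def by (metis length_filter_le length_upt minus_nat.diff_0)
  have "(\<Sum>a<length (old v). 90 * (length (As ! (old v ! a)) + 1)) \<le> 90 * (L + n)"
    using sum_length_old_le[of v] len by (simp add: sum.distrib flip: sum_distrib_left)
  then show ?thesis
    unfolding build_def runs_Seq runs_Store
    apply -
    apply (rule runs_mono[OF outer])
    \<comment> \<open>\<open>le_less\<close> splits off the final offset, which is stored after the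
      loop; the invariant covers only the earlier ones.\<close>
    using old len by (auto simp: same_def sub_lists_def le_less)
qed

end


section \<open>Printing equations\<close>

text \<open>Register 16 is the reading position in the buffer and 17 the number of terms of the
  current equation. The outer loop is no \<open>For\<close>, since the position advances by the
  varying length of an equation. Only variable numbers change, by lookup in segment 5.\<close>

definition translate :: prog where
  "translate = Seq (Store 16 (Const 0) (Const 0)) (Loop (Sub (reg 7) (reg 16))
    (Seq (Store 17 (Const 0) (Load 6 (reg 16)))
    (Seq (Print (reg 17))
    (Seq (incr 16)
    (For 11 (Const 0) (reg 17)
      (Seq (Print (Load 5 (Load 6 (reg 16))))
      (Seq (Print (Load 6 (Add (reg 16) (Const 1))))
      (Seq (Print (Load 6 (Add (reg 16) (Const 2))))
        (Store 16 (Const 0) (Add (reg 16) (Const 3)))))))))))"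

definition rename_equation :: "nat list \<Rightarrow> sparse_equation \<Rightarrow> sparse_equation" where
  "rename_equation xs ts = map (\<lambda>(i, p, q). (xs ! i, p, q)) ts"

definition print_term :: "nat \<times> int \<times> int \<Rightarrow> int list" where
  "print_term = (\<lambda>(i, p, q). [int i, p, q])"

lemma print_equation_terms: "print_equation ts = int (length ts) # concat (map print_term ts)"
  by (simp add: print_equation_def print_term_def)

lemma length_print_terms: "length (concat (map print_term ts)) = 3 * length ts"
  by (induction ts) (auto simp: print_term_def)

lemma arr_nth_append: "arr f (xs @ y # ys) \<Longrightarrow> l = int (length xs) \<Longrightarrow> f l = y"
  using arr_append[of f xs "y # ys" 0] by simp

lemma runs_translate:
  assumes arr: "arr (m 6) (concat (map print_equation tss))" "arr (m 5) (map int xs)"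
    and len: "m 7 0 = int (length (concat (map print_equation tss)))"
    and valid: "\<And>ts. ts \<in> set tss \<Longrightarrow> valid_equation (length xs) ts"
  shows "runs translate m out (\<lambda>t m' out'.
    t \<le> 100 * (length (concat (map print_equation tss)) + 1) \<and> same {11, 16, 17} m m' \<and>
    out' = out @ concat (map print_equation (map (rename_equation xs) tss)))"
proof -
  let ?p = "\<lambda>i. concat (map print_equation (take i tss))"
  let ?q = "\<lambda>i. concat (map print_equation (map (rename_equation xs) (take i tss)))"
  let ?I = "\<lambda>i m' out'. out' = out @ ?q i \<and> same {11, 16, 17} m m' \<and> m' 16 0 = int (length (?p i))"
  let ?bi = "Seq (Print (Load 5 (Load 6 (reg 16))))
      (Seq (Print (Load 6 (Add (reg 16) (Const 1))))
      (Seq (Print (Load 6 (Add (reg 16) (Const 2))))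
        (Store 16 (Const 0) (Add (reg 16) (Const 3)))))"
  let ?bo = "Seq (Store 17 (Const 0) (Load 6 (reg 16)))
    (Seq (Print (reg 17)) (Seq (incr 16) (For 11 (Const 0) (reg 17) ?bi)))"
  have inner: "runs (For 11 (Const 0) (reg 17) ?bi) m1 out1 (\<lambda>t m' out'.
      t \<le> (\<Sum>k<length ts. 40) + (length ts + 1) * (expr_cost (Const 0) + expr_cost (reg 17) + 20) \<and>
      same {11, 16} m1 m' \<and> m' 16 0 = int (length ys) + 3 * int (length ts) \<and>
      out' = out1 @ concat (map print_term (rename_equation xs (take (length ts) ts))))"
    if m1: "same {11, 16, 17} m m1" "m1 17 0 = int (length ts)" "m1 16 0 = int (length ys)"
      and a: "arr (m 6) (ys @ concat (map print_term ts) @ zs)" and v: "valid_equation (length xs) ts"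
    for m1 out1 ts ys zs
  proof -
    let ?J = "\<lambda>k m' out'. same {11, 16} m1 m' \<and> m' 16 0 = int (length ys) + 3 * int k \<and>
      out' = out1 @ concat (map print_term (rename_equation xs (take k ts)))"
    show ?thesis
    proof (rule runs_For[where a = 0 and Inv = ?J])
    fix k m' out'
    assume k: "k < length ts" and I: "?J k m' out'" and r: "m' 11 0 = 0 + int k"
    obtain i p q where t: "ts ! k = (i, p, q)" by (cases "ts ! k")
    have i: "i < length xs" using v k t unfolding valid_equation_def by (metis (no_types, lifting) case_prodD nth_mem)
    have e: "concat (map print_term ts) =
        concat (map print_term (take k ts)) @ int i # p # q # concat (map print_term (drop (Suc k) ts))"
      by (subst id_take_nth_drop[OF k]) (simp add: t print_term_def del: append_take_drop_id)
    have "m' 6 = m 6" "m' 5 = m 5" using I m1 by (auto simp: same_def)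
    moreover have "int (length ys) + 3 * int k = int (length (ys @ concat (map print_term (take k ts))))"
      using k by (simp add: length_print_terms)
    \<comment> \<open>The same buffer content, split before each of the three entries of the current
      term, so that \<open>arr_nth_append\<close> reads them off.\<close>
    moreover have "arr (m 6) ((ys @ concat (map print_term (take k ts))) @ int i # p # q # concat (map print_term (drop (Suc k) ts)) @ zs)"
      "arr (m 6) ((ys @ concat (map print_term (take k ts)) @ [int i]) @ p # q # concat (map print_term (drop (Suc k) ts)) @ zs)"
      "arr (m 6) ((ys @ concat (map print_term (take k ts)) @ [int i, p]) @ q # concat (map print_term (drop (Suc k) ts)) @ zs)"
      using a by (simp_all add: e)
    note this[THEN arr_nth_append]
    ultimately have "m' 6 (m' 16 0) = int i" "m' 6 (m' 16 0 + 1) = p" "m' 6 (m' 16 0 + 2) = q"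
      "m' 5 (int i) = int (xs ! i)"
      using I arr(2) i by (auto simp: arr_def ac_simps)
    then show "runs ?bi m' out' (\<lambda>t m'' out''. t \<le> 40 \<and> m'' 11 0 = 0 + int k \<and>
         ?J (Suc k) (m''(11 := (m'' 11)(0 := 0 + int k + 1))) out'')"
      using I r t k by (auto simp: same_def take_Suc_conv_app_nth rename_equation_def print_term_def)
    qed (use m1 in \<open>auto simp: same_def rename_equation_def\<close>)
  qed
  have outer: "runs (Loop (Sub (reg 7) (reg 16)) ?bo) m1 out (\<lambda>t m' out'.
      t \<le> (\<Sum>i<length tss. 80 * (length (tss ! i) + 1)) +
        (length tss + 1) * (1 + expr_cost (Sub (reg 7) (reg 16))) \<and> ?I (length tss) m' out')"
    if "same {16} m m1" "m1 16 0 = 0" for m1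
  proof (rule runs_Loop[where Inv = ?I])
    fix i m' out' assume i: "i < length tss" and I: "?I i m' out'"
    let ?ts = "tss ! i"
    have p: "?p (Suc i) = ?p i @ print_equation ?ts"
      and q: "?q (Suc i) = ?q i @ print_equation (rename_equation xs ?ts)"
      using i by (simp_all add: take_Suc_conv_app_nth)
    have c: "concat (map print_equation tss) =
      ?p i @ int (length ?ts) # concat (map print_term ?ts) @ concat (map print_equation (drop (Suc i) tss))"
      by (subst id_take_nth_drop[OF i]) (simp add: print_equation_terms)
    have m6: "m' 6 (m' 16 0) = int (length ?ts)"
      using arr(1) I unfolding c by (auto simp: same_def dest: arr_nth_append)
    \<comment> \<open>This also holds for an equation without terms, because its header occupies a
      cell.\<close>
    have cond: "eval_expr m' (Sub (reg 7) (reg 16)) > 0"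
      using len I unfolding c by (auto simp: same_def)
    have a: "arr (m 6) ((?p i @ [int (length ?ts)]) @ concat (map print_term ?ts) @ concat (map print_equation (drop (Suc i) tss)))"
      using arr(1) by (simp add: c)
    have "runs ?bo m' out' (\<lambda>t m'' out''. t \<le> 80 * (length ?ts + 1) \<and> ?I (Suc i) m'' out'')"
      unfolding runs_Seq runs_Store runs_Print
      apply (rule runs_mono[OF inner[OF _ _ _ a valid]])
      subgoal using I by (simp add: same_def)
      subgoal using m6 by simp
      subgoal using I by simp
      subgoal using i by simp
      subgoal using I m6 unfolding p q by (simp add: same_def print_equation_terms length_print_terms rename_equation_def)
      done
    with cond show "eval_expr m' (Sub (reg 7) (reg 16)) > 0 \<and>
      runs ?bo m' out' (\<lambda>t m'' out''. t \<le> 80 * (length ?ts + 1) \<and> ?I (Suc i) m'' out'')" by blast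
  qed (use that len in \<open>auto simp: same_def\<close>)
  have "(\<Sum>i<length tss. 80 * (length (tss ! i) + 1)) = (\<Sum>ts\<leftarrow>tss. 80 * (length ts + 1))"
    by (simp add: sum_list_sum_nth atLeast0LessThan)
  \<comment> \<open>An equation with k terms occupies 1 + 3k cells, so the cost per equation is
    charged to its own printed length.\<close>
  also have "\<dots> \<le> (\<Sum>ts\<leftarrow>tss. 80 * length (print_equation ts))"
    by (rule sum_list_mono) (simp add: print_equation_terms length_print_terms)
  also have "\<dots> = 80 * length (concat (map print_equation tss))"
    by (simp add: length_concat sum_list_const_mult comp_def)
  finally have "(\<Sum>i<length tss. 80 * (length (tss ! i) + 1)) \<le> 80 * length (concat (map print_equation tss))" .
  moreover have "length tss \<le> length (concat (map print_equation tss))"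
    by (induction tss) (auto simp: print_equation_def)
  ultimately show ?thesis
    unfolding translate_def runs_Seq runs_Store
    apply -
    apply (rule runs_mono[OF outer])
    by (auto simp: same_def)
qed

text \<open>A dense encoding: all \<open>n\<close> variables are listed, zero coefficients included,
  with denominator 1. It costs O(n) to print and needs no count of the nonzero terms in
  advance.\<close>

definition indicator_diff :: "nat \<Rightarrow> nat set \<Rightarrow> nat set \<Rightarrow> sparse_equation" where
  "indicator_diff n I J = map (\<lambda>i. (i, of_bool (i \<in> I) - of_bool (i \<in> J), 1)) [0..<n]"

definition print_diff :: prog where
  "print_diff = Seq (Print (reg 0)) (For 11 (Const 0) (reg 0)
    (Seq (Print (reg 11)) (Seq (Print (Sub (Load 9 (reg 11)) (Load 8 (reg 11)))) (Print (Const 1)))))"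

lemma runs_print_diff:
  assumes n: "m 0 0 = int n" and I: "\<forall>j<n. m 9 (int j) = of_bool (j \<in> I)"
    and J: "\<forall>j<n. m 8 (int j) = of_bool (j \<in> J)"
  shows "runs print_diff m out (\<lambda>t m' out'. t \<le> 100 * (n + 1) \<and> same {11} m m' \<and>
    out' = out @ print_equation (indicator_diff n I J))"
proof -
  let ?b = "Seq (Print (reg 11)) (Seq (Print (Sub (Load 9 (reg 11)) (Load 8 (reg 11)))) (Print (Const 1)))"
  let ?I = "\<lambda>i m' out'. same {11} m m' \<and>
    out' = out @ int n # concat (map print_term (take i (indicator_diff n I J)))"
  have 1: "runs (For 11 (Const 0) (reg 0) ?b) m (out @ [int n]) (\<lambda>t m' out'.
      t \<le> (\<Sum>i<n. 30) + (n + 1) * (expr_cost (Const 0) + expr_cost (reg 0) + 20) \<and> ?I n m' out')"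
  proof (rule runs_For[where a = 0 and Inv = ?I])
    fix i m' out' assume "i < n" "?I i m' out'" "m' 11 0 = 0 + int i"
    then show "runs ?b m' out' (\<lambda>t m'' out''. t \<le> 30 \<and> m'' 11 0 = 0 + int i \<and>
      ?I (Suc i) (m''(11 := (m'' 11)(0 := 0 + int i + 1))) out'')"
      using I J by (auto simp: same_def indicator_diff_def take_Suc_conv_app_nth print_term_def)
  qed (use n in \<open>auto simp: same_def\<close>)
  show ?thesis
    unfolding print_diff_def runs_Seq runs_Print
    using n by simp (rule runs_mono[OF 1], auto simp: print_equation_terms indicator_diff_def)
qed


section \<open>Greedy maximal independent sets\<close>

context adjacency
begin

text \<open>Independence together with domination: every vertex outside the set has a neighbor in
  it. This local form of maximality is what a single scan can establish.\<close>

definition maximal :: "nat set \<Rightarrow> bool" where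
  "maximal I \<longleftrightarrow> I \<subseteq> {..<n} \<and> (\<forall>i\<in>I. \<forall>j\<in>set (As ! i). j \<notin> I) \<and>
     (\<forall>i<n. i \<in> I \<or> (\<exists>j\<in>set (As ! i). j \<in> I))"

text \<open>The set always contains \<open>v\<close> and stays independent, and the vertices already
  scanned are dominated; as the set only grows, domination persists. The expression \<open>e\<close>
  is evaluated after segment \<open>s\<close> has been cleared, so its value is assumed for all
  memories that differ only in 11 and \<open>s\<close>.\<close>

lemma runs_greedy:
  assumes G: "graph_mem m" and v: "v < n"
    and e: "\<And>m'. same {11, s} m m' \<Longrightarrow> eval_expr m' e = int v"
    and s: "s = 8 \<or> s = 9" and cost: "expr_cost e \<le> 5"
  shows "runs (greedy s e) m out (\<lambda>t m' out'. t \<le> 400 * (n + L + 1) \<and> out' = out \<and>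
    same {11, 12, 15, s} m m' \<and>
    (\<exists>I. maximal I \<and> v \<in> I \<and> (\<forall>j<n. m' s (int j) = of_bool (j \<in> I))))"
proof -
  let ?I1 = "\<lambda>i m' out'. out' = out \<and> same {11, s} m m' \<and> (\<forall>j<i. m' s (int j) = 0)"
  have 1: "runs (For 11 (Const 0) (reg 0) (Store s (reg 11) (Const 0))) m out
    (\<lambda>t m' out'. t \<le> (\<Sum>i<n. 4) + (n + 1) * (expr_cost (Const 0) + expr_cost (reg 0) + 20) \<and>
      ?I1 n m' out')"
    using G s by (intro runs_For[where a = 0]) (auto simp: same_def graph_mem_def less_Suc_eq)
  let ?bn = "Store 15 (Const 0) (Add (reg 15) (Load s (Load 2 (reg 12))))"
  let ?b = "Seq (Store 15 (Const 0) (Const 0))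
      (Seq (Nbrs 12 (reg 11) ?bn) (Cond (reg 15) Skip (Store s (reg 11) (Const 1))))"
  have gm: "graph_mem m' \<and> m' 0 0 = int n" if "same {11, 12, 15, s} m m'" for m'
    using graph_mem_same[OF that] G s by (auto simp: graph_mem_def)
  have inner: "runs (Nbrs 12 (reg 11) ?bn) m1 out
    (\<lambda>t m' out'. t \<le> (length (As ! i) + 1) * (30 + 2 * expr_cost (reg 11) + 30) \<and>
      out' = out \<and> same {12, 15} m1 m' \<and>
      m' 15 0 = (\<Sum>j\<leftarrow>take (length (As ! i)) (As ! i). of_bool (j \<in> I)))"
    if m1: "same {11, 12, 15, s} m m1" "m1 15 0 = 0" "m1 11 0 = int i"
      and i: "i < n" and I: "\<forall>j<n. m1 s (int j) = of_bool (j \<in> I)"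
    for m1 i I
  proof (rule runs_Nbrs)
    show "i < n" by fact
    show "graph_mem m1" "eval_expr m1 (reg 11) = int i" using gm m1 by auto
    fix k m' out'
    assume J: "out' = out \<and> same {12, 15} m1 m' \<and>
      m' 15 0 = (\<Sum>j\<leftarrow>take k (As ! i). of_bool (j \<in> I))"
    then have "same {11, 12, 15, s} m m'" using m1(1) by (auto simp: same_def)
    then show "graph_mem m' \<and> eval_expr m' (reg 11) = int i" using gm J m1 by (auto simp: same_def)
    assume k: "k < length (As ! i)" and r: "m' 2 (m' 12 0) = int (As ! i ! k)"
    have "m' s (int (As ! i ! k)) = of_bool (As ! i ! k \<in> I)"
      using J I s range[OF i] k by (auto simp: same_def)
    then show "runs ?bn m' out' (\<lambda>t m'' out''. t \<le> 30 \<and> m'' 12 0 = m' 12 0 \<and>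
        out'' = out \<and> same {12, 15} m1 (m''(12 := (m'' 12)(0 := m' 12 0 + 1))) \<and>
        (m''(12 := (m'' 12)(0 := m' 12 0 + 1))) 15 0 =
          (\<Sum>j\<leftarrow>take (Suc k) (As ! i). of_bool (j \<in> I)))"
      using J k r by (auto simp: same_def take_Suc_conv_app_nth)
  qed (use m1 in \<open>auto simp: same_def\<close>)
  let ?P = "\<lambda>i I. I \<subseteq> {..<n} \<and> (\<forall>i\<in>I. \<forall>j\<in>set (As ! i). j \<notin> I) \<and> v \<in> I \<and>
     (\<forall>k<i. k \<in> I \<or> (\<exists>j\<in>set (As ! k). j \<in> I))"
  let ?I2 = "\<lambda>i m' out'. out' = out \<and> same {11, 12, 15, s} m m' \<and>
    (\<exists>I. ?P i I \<and> (\<forall>j<n. m' s (int j) = of_bool (j \<in> I)))"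
  have 2: "runs (For 11 (Const 0) (reg 0) ?b) m1 out
    (\<lambda>t m' out'. t \<le> (\<Sum>i<n. 100 * (length (As ! i) + 1)) +
        (n + 1) * (expr_cost (Const 0) + expr_cost (reg 0) + 20) \<and> ?I2 n m' out')"
    if m1: "same {11, s} m m1" "\<forall>j<n. m1 s (int j) = of_bool (j = v)" for m1
  proof (rule runs_For[where a = 0 and Inv = ?I2])
    have "?P 0 {v}" using v irrefl by auto
    then show "?I2 0 (m1(11 := (m1 11)(0 := 0))) out"
      using m1 s by (intro conjI exI[of _ "{v}"]) (auto simp: same_def)
  next
    fix i m' out' assume "?I2 i m' out'"
    then show "eval_expr m' (reg 0) = 0 + int n" using gm by auto
  next
    fix i m' out' assume i: "i < n" and J: "?I2 i m' out'" and r: "m' 11 0 = 0 + int i"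
    then obtain I where I: "?P i I" "\<forall>j<n. m' s (int j) = of_bool (j \<in> I)" by blast
    let ?sum = "\<Sum>j\<leftarrow>As ! i. of_bool (j \<in> I) :: int"
    have pos: "?sum > 0 \<longleftrightarrow> (\<exists>j\<in>set (As ! i). j \<in> I)"
    proof -
      have "(\<Sum>j\<leftarrow>xs. of_bool (j \<in> I) :: int) \<ge> 0 \<and>
        ((\<Sum>j\<leftarrow>xs. of_bool (j \<in> I) :: int) > 0 \<longleftrightarrow> (\<exists>j\<in>set xs. j \<in> I))" for xs
        by (induction xs) auto
      then show ?thesis by blast
    qed
    \<comment> \<open>If \<open>i\<close> is already in \<open>I\<close>, as happens for
      \<open>i = v\<close>, independence makes the sum 0, and inserting \<open>i\<close> changes
      nothing.\<close>
    define I' where "I' = (if ?sum > 0 then I else insert i I)"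
    have P: "?P (Suc i) I'"
    proof (cases "?sum > 0")
      case True
      then show ?thesis using I(1) pos by (auto simp: less_Suc_eq I'_def)
    next
      case False
      then have no: "\<forall>j\<in>set (As ! i). j \<notin> I" using pos by blast
      \<comment> \<open>The program inspects only the list of \<open>i\<close>; symmetry gives the
        condition on the lists of the other members.\<close>
      then have "\<forall>j\<in>I. i \<notin> set (As ! j)" using sym I(1) by blast
      then show ?thesis using False no I(1) i irrefl by (auto simp: less_Suc_eq I'_def)
    qed
    have fin: "?I2 (Suc i) M out" if "same {11, 12, 15, s} m M" "\<forall>j<n. M s (int j) = of_bool (j \<in> I')" for M
    proof (rule conjI[OF refl conjI[OF that(1)]], rule exI[of _ I'], rule conjI)
      show "?P (Suc i) I'" by (rule P)
      show "\<forall>j<n. M s (int j) = of_bool (j \<in> I')" by (rule that(2))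
    qed
    let ?m1 = "m'(15 := (m' 15)(0 := 0))"
    have "runs (Nbrs 12 (reg 11) ?bn) ?m1 out
      (\<lambda>t m'' out''. t \<le> (length (As ! i) + 1) * (30 + 2 * expr_cost (reg 11) + 30) \<and>
        out'' = out \<and> same {12, 15} ?m1 m'' \<and>
        m'' 15 0 = (\<Sum>j\<leftarrow>take (length (As ! i)) (As ! i). of_bool (j \<in> I)))"
      by (rule inner[OF _ _ _ i]) (use J I r s in \<open>auto simp: same_def\<close>)
    then have "runs (Nbrs 12 (reg 11) ?bn) ?m1 out
      (\<lambda>t m'' out''. runs (Cond (reg 15) Skip (Store s (reg 11) (Const 1))) m'' out''
        (\<lambda>t' m'' out''. 3 + t + t' \<le> 100 * (length (As ! i) + 1) \<and>
        m'' 11 0 = 0 + int i \<and> ?I2 (Suc i) (m''(11 := (m'' 11)(0 := 0 + int i + 1))) out''))"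
    proof (rule runs_mono, elim conjE)
      fix t m'' out''
      assume t: "t \<le> (length (As ! i) + 1) * (30 + 2 * expr_cost (reg 11) + 30)"
        and out: "out'' = out" and m'': "same {12, 15} ?m1 m''"
        and 15: "m'' 15 0 = (\<Sum>j\<leftarrow>take (length (As ! i)) (As ! i). of_bool (j \<in> I))"
      let ?m2 = "if ?sum > 0 then m'' else m''(s := (m'' s)(int i := 1))"
      let ?m3 = "?m2(11 := (?m2 11)(0 := 0 + int i + 1))"
      have 11: "m'' 11 0 = int i" using m'' r by (simp add: same_def)
      have "same {11, 12, 15, s} m ?m3" using J m'' by (auto simp: same_def)
      moreover have "\<forall>j<n. ?m3 s (int j) = of_bool (j \<in> I')"
      proof -
        have "m'' s = m' s" using m'' s by (auto simp: same_def)
        then show ?thesis using I(2) s by (auto simp: I'_def)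
      qed
      ultimately have I3: "?I2 (Suc i) ?m3 out" by (rule fin)
      show "runs (Cond (reg 15) Skip (Store s (reg 11) (Const 1))) m'' out''
        (\<lambda>t' m'' out''. 3 + t + t' \<le> 100 * (length (As ! i) + 1) \<and>
        m'' 11 0 = 0 + int i \<and> ?I2 (Suc i) (m''(11 := (m'' 11)(0 := 0 + int i + 1))) out'')"
      proof (cases "?sum > 0")
        case True
        then have "eval_expr m'' (reg 15) > 0" using 15 by simp
        with True I3 t 11 out show ?thesis unfolding runs_Cond by simp
      next
        case False
        then have "\<not> eval_expr m'' (reg 15) > 0" using 15 by simp
        moreover have "s \<noteq> 11" using s by auto
        ultimately show ?thesis using False I3 t 11 out unfolding runs_Cond by simp
      qed
    qed
    then show "runs ?b m' out' (\<lambda>t m'' out''. t \<le> 100 * (length (As ! i) + 1) \<and>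
        m'' 11 0 = 0 + int i \<and> ?I2 (Suc i) (m''(11 := (m'' 11)(0 := 0 + int i + 1))) out'')"
      using J by (simp add: add.assoc)
  qed simp
  have "(\<Sum>i<n. 100 * (length (As ! i) + 1)) = 100 * (L + n)"
    by (simp add: sum.distrib sum_length_nbrs flip: sum_distrib_left)
  then have t: "t + (1 + expr_cost e + expr_cost (Const 1) + t') \<le> 400 * (n + L + 1)"
    if "t \<le> (\<Sum>i<n. 4) + (n + 1) * (expr_cost (Const 0) + expr_cost (reg 0) + 20)"
      "t' \<le> (\<Sum>i<n. 100 * (length (As ! i) + 1)) +
        (n + 1) * (expr_cost (Const 0) + expr_cost (reg 0) + 20)" for t t'
    using that cost by simp
  show ?thesis
    unfolding greedy_def runs_Seq runs_Store
  proof (rule runs_mono[OF 1], elim conjE, hypsubst)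
    fix t m'
    assume *: "t \<le> (\<Sum>i<n. 4) + (n + 1) * (expr_cost (Const 0) + expr_cost (reg 0) + 20)"
      "same {11, s} m m'" "\<forall>j<n. m' s (int j) = 0"
    let ?m1 = "m'(s := (m' s)(eval_expr m' e := eval_expr m' (Const 1)))"
    have "same {11, s} m ?m1" "\<forall>j<n. ?m1 s (int j) = of_bool (j = v)"
      using * by (simp_all add: same_def e[OF *(2)])
    from 2[OF this] show "runs (For 11 (Const 0) (reg 0) ?b) ?m1 out
      (\<lambda>t' m' out'. t + (1 + expr_cost e + expr_cost (Const 1) + t') \<le> 400 * (n + L + 1) \<and>
        out' = out \<and> same {11, 12, 15, s} m m' \<and>
        (\<exists>I. maximal I \<and> v \<in> I \<and> (\<forall>j<n. m' s (int j) = of_bool (j \<in> I))))"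
      by (rule runs_mono) (use t[OF *(1)] in \<open>auto simp only: maximal_def\<close>)
  qed
qed

end


section \<open>Well-covered weightings and closed neighborhoods\<close>

text \<open>\<open>independent_set\<close> also quantifies over equal vertices, where the pair
  collapses to a singleton; edges have two elements.\<close>

lemma no_loop: "finite_simple_graph G \<Longrightarrow> {v, v} \<notin> edges G"
  by (auto simp: finite_simple_graph_def)

lemma independent_delete_subset: "independent_set (delete_verts G X) I \<Longrightarrow> I \<subseteq> verts G - X"
  by (simp add: independent_set_def delete_verts_def)

lemma independent_insert:
  assumes "finite_simple_graph G" "v \<in> verts G"
    and "independent_set (delete_verts G (closed_nbhd G v)) I"
  shows "independent_set G (insert v I)"
  unfolding independent_set_def
proof (intro conjI ballI)
  have I: "u \<in> verts G" "u \<noteq> v" "{u, v} \<notin> edges G" if "u \<in> I" for u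
    using assms(3) that by (auto simp: independent_set_def delete_verts_def closed_nbhd_def)
  then show "insert v I \<subseteq> verts G" using assms(2) by auto
  fix a b assume ab: "a \<in> insert v I" "b \<in> insert v I"
  have "{a, b} \<notin> edges G" if "a \<in> I" "b \<in> I"
  proof
    assume "{a, b} \<in> edges G"
    then have "{a, b} \<in> edges (delete_verts G (closed_nbhd G v))"
      using I that by (auto simp: delete_verts_def closed_nbhd_def)
    then show False using assms(3) that by (auto simp: independent_set_def)
  qed
  then show "{a, b} \<notin> edges G"
    using ab I no_loop[OF assms(1), of v] by (auto simp: insert_commute)
qed

lemma independent_remove:
  assumes "independent_set G I" "v \<in> I"
  shows "independent_set (delete_verts G (closed_nbhd G v)) (I - {v})"
proof -
  have "{u, v} \<notin> edges G" if "u \<in> I" for u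
    using assms that by (simp add: independent_set_def)
  then show ?thesis
    using assms by (auto simp: independent_set_def delete_verts_def closed_nbhd_def)
qed

lemma maximal_independent_setI:
  "independent_set G I \<Longrightarrow> (\<And>J. independent_set G J \<Longrightarrow> I \<subset> J \<Longrightarrow> False) \<Longrightarrow> maximal_independent_set G I"
  unfolding maximal_independent_set_def by blast

lemma maximal_independent_setD:
  assumes "maximal_independent_set G I"
  shows "independent_set G I" "\<And>J. independent_set G J \<Longrightarrow> I \<subset> J \<Longrightarrow> False"
  using assms unfolding maximal_independent_set_def by blast+

text \<open>A larger independent set of \<open>G\<close> would contain \<open>v\<close>, and
  removing \<open>v\<close> from it would enlarge \<open>I\<close> inside G - N[v].\<close>

lemma maximal_independent_insert:
  assumes G: "finite_simple_graph G" "v \<in> verts G"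
    and I: "maximal_independent_set (delete_verts G (closed_nbhd G v)) I"
  shows "maximal_independent_set G (insert v I)" "v \<notin> I"
proof -
  let ?H = "delete_verts G (closed_nbhd G v)"
  show v: "v \<notin> I"
    using independent_delete_subset[OF maximal_independent_setD(1)[OF I]]
    by (auto simp: closed_nbhd_def)
  have "False" if J: "independent_set G J" "insert v I \<subset> J" for J
  proof -
    have "v \<in> J" using J(2) by blast
    then have "independent_set ?H (J - {v})" by (rule independent_remove[OF J(1)])
    moreover have "I \<subset> J - {v}" using J(2) v by blast
    ultimately show False by (rule maximal_independent_setD(2)[OF I])
  qed
  then show "maximal_independent_set G (insert v I)"
    by (rule maximal_independent_setI[OF independent_insert[OF G maximal_independent_setD(1)[OF I]]])
qed

lemma maximal_independent_remove:
  assumes G: "finite_simple_graph G" and I: "maximal_independent_set G I" "v \<in> I"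
  shows "maximal_independent_set (delete_verts G (closed_nbhd G v)) (I - {v})"
proof -
  let ?H = "delete_verts G (closed_nbhd G v)"
  have v: "v \<in> verts G" using maximal_independent_setD(1)[OF I(1)] I(2) by (auto simp: independent_set_def)
  have "False" if J: "independent_set ?H J" "I - {v} \<subset> J" for J
  proof -
    have "independent_set G (insert v J)" using independent_insert[OF G v J(1)] .
    moreover have "v \<notin> J"
      using independent_delete_subset[OF J(1)] by (auto simp: closed_nbhd_def)
    then have "I \<subset> insert v J" using J(2) by blast
    ultimately show False by (rule maximal_independent_setD(2)[OF I(1)])
  qed
  then show ?thesis
    by (rule maximal_independent_setI[OF independent_remove[OF maximal_independent_setD(1)[OF I(1)] I(2)]])
qed

lemma maximal_independent_finite:
  "finite_simple_graph G \<Longrightarrow> maximal_independent_set G I \<Longrightarrow> finite I"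
  by (meson finite_simple_graph_def finite_subset independent_set_def maximal_independent_setD(1))

lemma well_coveredD:
  "well_covered_weighting G w \<Longrightarrow> maximal_independent_set G I \<Longrightarrow> maximal_independent_set G J \<Longrightarrow>
    sum w I = sum w J"
  unfolding well_covered_weighting_def by iprover

lemma well_covered_delete:
  assumes G: "finite_simple_graph G" "v \<in> verts G" and w: "well_covered_weighting G w"
  shows "well_covered_weighting (delete_verts G (closed_nbhd G v)) w"
  unfolding well_covered_weighting_def
proof (intro allI impI, elim conjE)
  fix I J
  assume I: "maximal_independent_set (delete_verts G (closed_nbhd G v)) I"
    and J: "maximal_independent_set (delete_verts G (closed_nbhd G v)) J"
  note I' = maximal_independent_insert[OF G I] and J' = maximal_independent_insert[OF G J]
  have "finite I" "finite J" using maximal_independent_finite[OF G(1)] maximal_independent_insert[OF G] I J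
    by (meson finite_insert)+
  moreover have "sum w (insert v I) = sum w (insert v J)"
    by (rule well_coveredD[OF w I'(1) J'(1)])
  ultimately show "sum w I = sum w J" using I' J' by simp
qed

lemma well_covered_same_vertex:
  assumes G: "finite_simple_graph G"
    and w: "well_covered_weighting (delete_verts G (closed_nbhd G v)) w"
    and I: "maximal_independent_set G I" "v \<in> I" and J: "maximal_independent_set G J" "v \<in> J"
  shows "sum w I = sum w J"
proof -
  have "sum w (I - {v}) = sum w (J - {v})"
    by (rule well_coveredD[OF w maximal_independent_remove[OF G I] maximal_independent_remove[OF G J]])
  then show ?thesis
    using I J maximal_independent_finite[OF G] by (simp add: sum.remove)
qed

text \<open>Any maximal independent set contains some vertex \<open>v\<close>. Its weight equals
  that of the sample set through \<open>v\<close>, by the condition on G - N[v], then that of a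
  sample set through \<open>u\<close>; and all sets through \<open>u\<close> agree by the condition
  on G - N[u].\<close>

lemma well_coveredI:
  assumes G: "finite_simple_graph G" and u: "u \<in> verts G"
    and w: "\<And>v. v \<in> verts G \<Longrightarrow> well_covered_weighting (delete_verts G (closed_nbhd G v)) w"
    and eq: "\<And>v. v \<in> verts G \<Longrightarrow> v \<noteq> u \<Longrightarrow> \<exists>I J. maximal_independent_set G I \<and> v \<in> I \<and>
      maximal_independent_set G J \<and> u \<in> J \<and> sum w I = sum w J"
  shows "well_covered_weighting G w"
proof -
  have "\<exists>J. maximal_independent_set G J \<and> u \<in> J \<and> sum w I = sum w J"
    if I: "maximal_independent_set G I" for I
  proof -
    \<comment> \<open>The existence of \<open>u\<close> enters here: a graph without vertices has
      the empty set as a maximal independent set.\<close>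
    have "I \<noteq> {}"
    proof
      assume "I = {}"
      moreover have "independent_set G {u}"
        using u no_loop[OF G, of u] by (auto simp: independent_set_def)
      ultimately show False using maximal_independent_setD(2)[OF I] by blast
    qed
    then obtain v where v: "v \<in> I" by blast
    then have vG: "v \<in> verts G" using maximal_independent_setD(1)[OF I] v by (auto simp: independent_set_def)
    show ?thesis
    proof (cases "v = u")
      case True
      then show ?thesis using I v by blast
    next
      case False
      with eq[OF vG] well_covered_same_vertex[OF G w[OF vG] I v] show ?thesis by metis
    qed
  qed
  then show ?thesis
    unfolding well_covered_weighting_def using well_covered_same_vertex[OF G w[OF u]] by metis
qed

section \<open>Passing between vertices of the graph and their numbers\<close>

locale listed_graph =
  fixes G :: "'a graph" and vs :: "'a list" and As :: "nat list list"
  assumes simple: "finite_simple_graph G" and lists: "adjacency_lists G vs As"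
begin

lemma enumeration: "distinct vs" "set vs = verts G" "length vs = length As"
  and nbrs: "\<And>i. i < length As \<Longrightarrow> set (As ! i) = {j. j < length As \<and> {vs ! i, vs ! j} \<in> edges G}"
  and distinct_nbrs: "\<And>i. i < length As \<Longrightarrow> distinct (As ! i)"
  using lists by (auto simp: adjacency_lists_def)

sublocale adjacency As
  by unfold_locales (use nbrs no_loop[OF simple] in \<open>auto simp: insert_commute\<close>)

lemma nth_verts [simp]: "i < n \<Longrightarrow> vs ! i \<in> verts G"
  using enumeration by (metis nth_mem)

lemma nth_vs_eq_iff [simp]: "i < n \<Longrightarrow> j < n \<Longrightarrow> vs ! i = vs ! j \<longleftrightarrow> i = j"
  using enumeration by (simp add: nth_eq_iff_index_eq)

abbreviation subgraph :: "nat \<Rightarrow> 'a graph" where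
  "subgraph v \<equiv> delete_verts G (closed_nbhd G (vs ! v))"

abbreviation sub_vs :: "nat \<Rightarrow> 'a list" where
  "sub_vs v \<equiv> map ((!) vs) (old v)"

lemma closed_nbhd_iff:
  "v < n \<Longrightarrow> j < n \<Longrightarrow> vs ! j \<in> closed_nbhd G (vs ! v) \<longleftrightarrow> \<not> kept v j"
  by (auto simp: closed_nbhd_def kept_def nbrs insert_commute)

lemma verts_eq: "verts G = (!) vs ` {..<n}"
  using enumeration by (metis atLeast_upt list.set_map map_nth)

lemma set_sub_vs: "v < n \<Longrightarrow> set (sub_vs v) = verts (subgraph v)"
  by (auto simp: old_def delete_verts_def verts_eq closed_nbhd_iff)

lemma edges_subgraph_iff:
  "v < n \<Longrightarrow> i < n \<Longrightarrow> j < n \<Longrightarrow> kept v i \<Longrightarrow> kept v j \<Longrightarrow>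
    {vs ! i, vs ! j} \<in> edges (subgraph v) \<longleftrightarrow> j \<in> set (As ! i)"
  by (simp add: delete_verts_def closed_nbhd_iff nbrs)

lemma inj_on_new: "inj_on (new v) {j. j < n \<and> kept v j}"
  by (rule inj_on_inverseI[where g = "(!) (old v)"]) (simp add: nth_old_new)

text \<open>Edges between kept vertices are the same in \<open>G\<close> and in the subgraph, so
  filtering and renumbering the lists suffices; injectivity of \<open>new v\<close> on kept numbers
  preserves distinctness.\<close>

lemma adjacency_lists_sub:
  assumes "v < n"
  shows "adjacency_lists (subgraph v) (sub_vs v) (sub_lists v)"
  unfolding adjacency_lists_def
proof (intro conjI allI impI)
  show "distinct (sub_vs v)"
    using distinct_old nth_vs_eq_iff by (auto simp: distinct_map inj_on_def old_def)
  show "set (sub_vs v) = verts (subgraph v)" using assms by (rule set_sub_vs)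
  show "length (sub_lists v) = length (sub_vs v)" by (simp add: sub_lists_def)
  fix a assume "a < length (sub_vs v)"
  then have a: "a < length (old v)" by simp
  let ?i = "old v ! a"
  have i: "?i < n" "kept v ?i" using nth_old[OF a] by auto
  have eq: "sub_lists v ! a = map (new v) (filter (kept v) (As ! ?i))"
    using a by (simp add: sub_lists_def)
  have "set (filter (kept v) (As ! ?i)) \<subseteq> {j. j < n \<and> kept v j}" using range[OF i(1)] by auto
  then show "distinct (sub_lists v ! a)"
    unfolding eq using distinct_nbrs[OF i(1)] inj_on_subset[OF inj_on_new] by (simp add: distinct_map)
  show "set (sub_lists v ! a) =
    {b. b < length (sub_vs v) \<and> {sub_vs v ! a, sub_vs v ! b} \<in> edges (subgraph v)}" (is "_ = ?R")
  proof (intro equalityI subsetI)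
    fix b assume "b \<in> set (sub_lists v ! a)"
    then obtain j where j: "b = new v j" "kept v j" "j \<in> set (As ! ?i)" unfolding eq by auto
    then have "j < n" using range i by blast
    then show "b \<in> ?R"
      using j a i assms nth_old_new[of v j] edges_subgraph_iff[of v ?i j] by simp
  next
    fix b assume b: "b \<in> ?R"
    then have bl: "b < length (old v)" by simp
    then have "old v ! b \<in> set (As ! ?i)"
      using b a i assms nth_old[OF bl] edges_subgraph_iff[of v ?i "old v ! b"] by simp
    then show "b \<in> set (sub_lists v ! a)"
      unfolding eq using nth_old[OF bl] new_nth_old[OF bl] by force
  qed
qed

text \<open>Handshake bound. A list entry is an ordered adjacent pair; it is mapped injectively to
  its edge and the bit \<open>i < j\<close>, which separates the two orientations.\<close>

lemma length_concat_le: "L \<le> 2 * card (edges G)"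
proof -
  let ?P = "SIGMA i:{..<n}. set (As ! i)"
  let ?f = "\<lambda>(i, j). ({vs ! i, vs ! j}, i < j)"
  have "L = (\<Sum>i<n. card (set (As ! i)))"
    unfolding sum_length_nbrs[symmetric] by (intro sum.cong) (simp_all add: distinct_card distinct_nbrs)
  also have "\<dots> = card ?P" by simp
  also have "\<dots> \<le> card (edges G \<times> (UNIV :: bool set))"
  proof (rule card_inj_on_le[of ?f])
    show "inj_on ?f ?P"
    proof (rule inj_onI)
      fix x y assume xy: "x \<in> ?P" "y \<in> ?P" "?f x = ?f y"
      obtain i j i' j' where x: "x = (i, j)" and y: "y = (i', j')" by (cases x, cases y)
      then have "j < n" "j' < n" using range xy by auto
      with xy show "x = y"
        unfolding x y using irrefl[of i] irrefl[of i']
        by (cases i j rule: linorder_cases) (auto simp: doubleton_eq_iff)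
    qed
    show "?f ` ?P \<subseteq> edges G \<times> UNIV" using nbrs by auto
    have "edges G \<subseteq> Pow (verts G)" using simple by (auto simp: finite_simple_graph_def)
    then have "finite (edges G)"
      using simple finite_subset by (auto simp: finite_simple_graph_def)
    then show "finite (edges G \<times> (UNIV :: bool set))" by simp
  qed
  finally show ?thesis by (simp add: card_cartesian_product mult.commute)
qed

lemma maximal_independent:
  assumes "maximal I"
  shows "maximal_independent_set G ((!) vs ` I)"
proof -
  have I: "i < n" if "i \<in> I" for i using assms that by (auto simp: maximal_def)
  have adj: "{vs ! i, vs ! j} \<in> edges G \<longleftrightarrow> j \<in> set (As ! i)" if "i < n" "j < n" for i j
    using that by (simp add: nbrs)
  have "independent_set G ((!) vs ` I)"
    using assms I adj by (auto simp: independent_set_def maximal_def)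
  moreover have False if J: "independent_set G J" "(!) vs ` I \<subset> J" for J
  proof -
    from J obtain x where x: "x \<in> J" "x \<notin> (!) vs ` I" by blast
    then obtain i where i: "i < n" "x = vs ! i"
      using J(1) by (auto simp: independent_set_def verts_eq)
    then have "i \<notin> I" using x by auto
    then obtain j where "j \<in> set (As ! i)" "j \<in> I" using assms i by (auto simp: maximal_def)
    then have "{x, vs ! j} \<in> edges G" "vs ! j \<in> J" using adj i I J by auto
    then show False using J(1) x by (auto simp: independent_set_def)
  qed
  ultimately show ?thesis by (rule maximal_independent_setI)
qed

text \<open>Term by term, \<open>vs ! (old v ! i)\<close> is \<open>sub_vs v ! i\<close>; validity
  provides the index bound.\<close>

lemma equation_coeff_rename:
  assumes "valid_equation (length (old v)) ts"
  shows "equation_coeff vs (rename_equation (old v) ts) = equation_coeff (sub_vs v) ts"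
  unfolding equation_coeff_def rename_equation_def
  using assms by (fastforce simp: valid_equation_def comp_def intro!: ext arg_cong[of _ _ sum_list])

lemma valid_rename:
  assumes "valid_equation (length (old v)) ts"
  shows "valid_equation n (rename_equation (old v) ts)"
proof -
  have "map fst (rename_equation (old v) ts) = map ((!) (old v)) (map fst ts)"
    by (simp add: rename_equation_def case_prod_unfold)
  moreover have "inj_on ((!) (old v)) (set (map fst ts))"
    by (rule inj_on_nth[OF distinct_old]) (use assms in \<open>auto simp: valid_equation_def\<close>)
  ultimately have "distinct (map fst (rename_equation (old v) ts))"
    using assms by (metis distinct_map valid_equation_def)
  then show ?thesis
    using assms nth_old by (auto simp: valid_equation_def rename_equation_def)
qed

text \<open>Applied to the vertices of N[v]: they get coefficient 0, so an equation of the subgraph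
  can be read as one over all of \<open>G\<close>.\<close>

lemma equation_coeff_outside:
  assumes "valid_equation (length xs) ts" "u \<notin> set xs"
  shows "equation_coeff xs ts u = 0"
proof -
  have "map (\<lambda>(i, p, q). if xs ! i = u then real_of_int p / real_of_int q else 0) ts = map (\<lambda>_. 0) ts"
    using assms by (fastforce simp: valid_equation_def)
  then show ?thesis unfolding equation_coeff_def by (simp only:) simp
qed

lemma finite_verts: "finite (verts G)"
  using simple by (simp add: finite_simple_graph_def)

lemma sum_equation_sub:
  assumes "v < n" "valid_equation (length (old v)) ts"
  shows "(\<Sum>u\<in>verts G. equation_coeff vs (rename_equation (old v) ts) u * w u) =
    (\<Sum>u\<in>verts (subgraph v). equation_coeff (sub_vs v) ts u * w u)"
  unfolding equation_coeff_rename[OF assms(2)]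
proof (rule sum.mono_neutral_right[OF finite_verts])
  show "verts (subgraph v) \<subseteq> verts G" by (auto simp: delete_verts_def)
  show "\<forall>u\<in>verts G - verts (subgraph v). equation_coeff (sub_vs v) ts u * w u = 0"
    using equation_coeff_outside[of "sub_vs v" ts] assms set_sub_vs by auto
qed

lemma equation_coeff_indicator_diff:
  assumes "i < n"
  shows "equation_coeff vs (indicator_diff n I J) (vs ! i) = of_bool (i \<in> I) - of_bool (i \<in> J)"
proof -
  have "equation_coeff vs (indicator_diff n I J) (vs ! i) =
      (\<Sum>k<n. if vs ! k = vs ! i then of_bool (k \<in> I) - of_bool (k \<in> J) else 0)"
    by (simp add: equation_coeff_def indicator_diff_def comp_def interv_sum_list_conv_sum_set_nat
        atLeast0LessThan cong: if_cong)
  also have "\<dots> = (\<Sum>k<n. if k = i then of_bool (k \<in> I) - of_bool (k \<in> J) else 0)"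
    using assms by (intro sum.cong) auto
  finally show ?thesis using assms by simp
qed

lemma sum_equation_indicator_diff:
  assumes "I \<subseteq> {..<n}" "J \<subseteq> {..<n}"
  shows "(\<Sum>u\<in>verts G. equation_coeff vs (indicator_diff n I J) u * w u) =
    sum w ((!) vs ` I) - sum w ((!) vs ` J)"
proof -
  have inj: "inj_on ((!) vs) K" if "K \<subseteq> {..<n}" for K
    using that by (auto simp: inj_on_def subset_iff)
  have "(\<Sum>u\<in>verts G. equation_coeff vs (indicator_diff n I J) u * w u) =
      (\<Sum>i<n. (of_bool (i \<in> I) - of_bool (i \<in> J)) * w (vs ! i))"
    unfolding verts_eq by (simp add: sum.reindex inj equation_coeff_indicator_diff)
  also have "\<dots> = (\<Sum>i<n. if i \<in> I then w (vs ! i) else 0) - (\<Sum>i<n. if i \<in> J then w (vs ! i) else 0)"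
    unfolding sum_subtractf[symmetric] by (intro sum.cong) auto
  also have "\<dots> = (\<Sum>i\<in>I. w (vs ! i)) - (\<Sum>i\<in>J. w (vs ! i))"
    using assms by (simp add: sum.inter_restrict[symmetric] Int_absorb1)
  finally show ?thesis using assms by (simp add: sum.reindex inj)
qed

lemma valid_indicator_diff: "valid_equation n (indicator_diff n I J)"
  by (auto simp: valid_equation_def indicator_diff_def comp_def)

end


section \<open>The algorithm\<close>

text \<open>Resetting register 7 empties the output buffer. The set through vertex 0 is recomputed
  in each round, within the linear cost per vertex. The final test suppresses the comparison when
  the current vertex is number 0.\<close>

definition vertex_prog :: "prog \<Rightarrow> prog" where
  "vertex_prog p = Seq mark (Seq renumber (Seq build (Seq (Store 7 (Const 0) (Const 0))
    (Seq (shift_prog p) (Seq translate (Seq (greedy 8 (Const 0)) (Seq (greedy 9 (reg 10))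
    (Cond (reg 10) print_diff Skip))))))))"

definition main_prog :: "prog \<Rightarrow> prog" where
  "main_prog p = For 10 (Const 0) (reg 0) (vertex_prog p)"

context listed_graph
begin

definition solves :: "sparse_equation list \<Rightarrow> ('a \<Rightarrow> real) \<Rightarrow> bool" where
  "solves tss w \<longleftrightarrow> (\<forall>ts\<in>set tss. (\<Sum>u\<in>verts G. equation_coeff vs ts u * w u) = 0)"

text \<open>
  The set \<open>J\<close> may differ from block to block: once \<open>G - N[v\<^sub>0]\<close> is known to be well-covered by
  \<open>w\<close>, all maximal independent sets containing \<open>v\<^sub>0 = vs ! 0\<close> have the same weight.
\<close>
definition block :: "real set \<Rightarrow> nat \<Rightarrow> sparse_equation list \<Rightarrow> bool" where
  "block C v tss \<longleftrightarrow> (\<forall>ts\<in>set tss. valid_equation n ts \<and> (\<forall>u\<in>verts G. equation_coeff vs ts u \<in> C)) \<and>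
    (\<exists>I J. maximal_independent_set G I \<and> vs ! v \<in> I \<and> maximal_independent_set G J \<and> vs ! 0 \<in> J \<and>
      (\<forall>w. solves tss w \<longleftrightarrow>
        well_covered_weighting (subgraph v) w \<and> (v > 0 \<longrightarrow> sum w I = sum w J)))"

text \<open>The assumption on the given program for a single subgraph, with natural number bounds
  \<open>F\<close> and \<open>K\<close> independent of \<open>v\<close>; real-valued bounds enter
  only in the final theorem.\<close>

definition solver :: "real set \<Rightarrow> prog \<Rightarrow> nat \<Rightarrow> nat \<Rightarrow> nat \<Rightarrow> bool" where
  "solver C p F K v \<longleftrightarrow> (\<forall>mem. graph_in_memory (subgraph v) (sub_vs v) mem \<longrightarrow>
    (\<exists>t mem' out S. exec p (mem, []) t (mem', out) \<and> t \<le> F \<and> prints_system (sub_vs v) out S \<and>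
      well_covering_system (subgraph v) S \<and> coefficients_in C (subgraph v) S \<and> length S \<le> K))"

lemma block_append:
  assumes v: "v < n" and C: "{-1, 0, 1} \<subseteq> C"
    and tss: "\<forall>ts\<in>set tss. valid_equation (length (sub_vs v)) ts"
    and S: "well_covering_system (subgraph v) (map (equation_coeff (sub_vs v)) tss)"
      "coefficients_in C (subgraph v) (map (equation_coeff (sub_vs v)) tss)"
    and I: "maximal I" "v \<in> I" and J: "maximal J" "0 \<in> J"
  shows "block C v (map (rename_equation (old v)) tss @ (if v > 0 then [indicator_diff n I J] else []))"
proof -
  have valid: "valid_equation (length (old v)) ts" if "ts \<in> set tss" for ts using tss that by simp
  have "equation_coeff vs (rename_equation (old v) ts) u \<in> C" if "ts \<in> set tss" for ts u
  proof (cases "u \<in> verts (subgraph v)")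
    case True
    then show ?thesis
      using S(2) that by (auto simp: coefficients_in_def equation_coeff_rename[OF valid])
  next
    case False
    then have "equation_coeff (sub_vs v) ts u = 0"
      using tss that set_sub_vs[OF v] by (intro equation_coeff_outside) auto
    then show ?thesis using C that by (simp add: equation_coeff_rename[OF valid])
  qed
  moreover have "equation_coeff vs (indicator_diff n I J) u \<in> C" if "u \<in> verts G" for u
    using that C by (auto simp: verts_eq equation_coeff_indicator_diff)
  moreover have "solves (map (rename_equation (old v)) tss @ (if v > 0 then [indicator_diff n I J] else [])) w
    \<longleftrightarrow> well_covered_weighting (subgraph v) w \<and> (v > 0 \<longrightarrow> sum w ((!) vs ` I) = sum w ((!) vs ` J))" for w
  proof -
    have "well_covered_weighting (subgraph v) w \<longleftrightarrow>
        (\<forall>ts\<in>set tss. (\<Sum>u\<in>verts (subgraph v). equation_coeff (sub_vs v) ts u * w u) = 0)"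
      using S(1) unfolding well_covering_system_def by simp
    also have "\<dots> \<longleftrightarrow> solves (map (rename_equation (old v)) tss) w"
      using sum_equation_sub[OF v valid] by (simp add: solves_def)
    finally show ?thesis
      using I J sum_equation_indicator_diff[of I J w] by (auto simp: solves_def maximal_def)
  qed
  ultimately show ?thesis
    unfolding block_def
    using maximal_independent[OF I(1)] maximal_independent[OF J(1)] I(2) J(2)
      valid_rename[OF valid] valid_indicator_diff
    by (intro conjI exI[of _ "(!) vs ` I"] exI[of _ "(!) vs ` J"]) auto
qed

lemma runs_vertex_prog:
  assumes C: "{-1, 0, 1} \<subseteq> C" and G: "graph_mem m" and v: "m 10 0 = int v" "v < n"
    and p: "solver C p F K v"
  shows "runs (vertex_prog p) m out (\<lambda>t m' out'. t \<le> 2000 * (n + L + 1) + 200 * F \<and>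
    same (- {0, 1, 2, 10}) m m' \<and> (\<exists>tss. out' = out @ concat (map print_equation tss) \<and>
      block C v tss \<and> length tss \<le> K + of_bool (v > 0)))"
proof -
  have Gs: "graph_mem m' \<and> m' 10 0 = int v" if "same (- {0, 1, 2, 10}) m m'" for m'
    using graph_mem_same[OF that] G v that by (auto simp: same_def)
  from runs_mark[OF G v, of out, unfolded runs_def] obtain t1 m1 where
    1: "exec mark (m, out) t1 (m1, out)" "t1 \<le> 100 * (n + L + 1)" "same {3, 11, 12} m m1"
      "\<forall>j<n. m1 3 (int j) = of_bool (\<not> kept v j)" by blast
  have s1: "same (- {0, 1, 2, 10}) m m1" using 1 by (auto simp: same_def)
  from runs_renumber[of m1 v out, OF Gs[OF s1, THEN conjunct1] 1(4), unfolded runs_def] obtain t2 m2 where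
    2: "exec renumber (m1, out) t2 (m2, out)" "t2 \<le> 100 * (n + 1)" "same {4, 5, 11, 13} m1 m2"
      "m2 13 0 = int (length (old v))" "arr (m2 5) (map int (old v))"
      "\<forall>j<n. kept v j \<longrightarrow> m2 4 (int j) = int (new v j)" by blast
  have s2: "same (- {0, 1, 2, 10}) m m2" using 2 s1 by (auto simp: same_def)
  have "\<forall>j<n. m2 3 (int j) = of_bool (\<not> kept v j)" using 1(4) 2(3) by (auto simp: same_def)
  from runs_build[of m2 v out, OF Gs[OF s2, THEN conjunct1] this 2(4-6), unfolded runs_def] obtain t3 m3 where
    3: "exec build (m2, out) t3 (m3, out)" "t3 \<le> 200 * (n + L + 1)"
      "same {11, 12, 14, 20, 21, 22} m2 m3" "m3 20 0 = int (length (old v))"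
      "\<forall>a\<le>length (old v). m3 21 (int a) = int (length (concat (take a (sub_lists v))))"
      "arr (m3 22) (map int (concat (sub_lists v)))" by blast
  have s3: "same (- {0, 1, 2, 10}) m m3" using 3 s2 by (auto simp: same_def)
  let ?m4 = "m3(7 := (m3 7)(0 := 0))"
  have 4: "exec (Store 7 (Const 0) (Const 0)) (m3, out) 3 (?m4, out)"
    using exec.Store[of 7 "Const 0" "Const 0" m3 out] by (simp add: numeral_3_eq_3)
  let ?M = "\<lambda>s. ?m4 (s + 20)"
  \<comment> \<open>Only the cells written by \<open>build\<close> are constrained; whatever earlier
    rounds left elsewhere from segment 20 on is allowed.\<close>
  have "graph_in_memory (subgraph v) (sub_vs v) ?M"
    unfolding graph_in_memory_def
    by (rule exI[of _ "sub_lists v"])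
      (use adjacency_lists_sub[OF v(2)] 3 in \<open>simp add: arr_def\<close>)
  with p obtain tp Mp outp tss where
    p: "exec p (?M, []) tp (Mp, outp)" "tp \<le> F" "outp = concat (map print_equation tss)"
      "\<forall>ts\<in>set tss. valid_equation (length (sub_vs v)) ts"
      "well_covering_system (subgraph v) (map (equation_coeff (sub_vs v)) tss)"
      "coefficients_in C (subgraph v) (map (equation_coeff (sub_vs v)) tss)" "length tss \<le> K"
    unfolding solver_def prints_system_def by (metis length_map)
  have "sim (?M, []) ?m4" by (simp add: sim_def)
  from exec_shift_prog[OF p(1) this, of out, unfolded runs_def] obtain t5 m5 where
    5: "exec (shift_prog p) (?m4, out) t5 (m5, out)" "t5 \<le> 9 * tp" "sim (Mp, outp) m5"
      "same ({6, 7} \<union> {20..}) ?m4 m5" by blast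
  have s5: "same (- {0, 1, 2, 10}) m m5" using 5(4) s3 by (auto simp: same_def)
  have "m5 5 = m2 5" using 5(4) 3(3) by (auto simp: same_def)
  then have "arr (m5 5) (map int (old v))" using 2(5) by simp
  moreover have "arr (m5 6) (concat (map print_equation tss))"
    "m5 7 0 = int (length (concat (map print_equation tss)))"
    using 5(3) p(3) by (simp_all add: sim_def)
  moreover have "valid_equation (length (old v)) ts" if "ts \<in> set tss" for ts using p(4) that by simp
  ultimately have "runs translate m5 out (\<lambda>t m' out'.
    t \<le> 100 * (length (concat (map print_equation tss)) + 1) \<and> same {11, 16, 17} m5 m' \<and>
    out' = out @ concat (map print_equation (map (rename_equation (old v)) tss)))"
    by (intro runs_translate) auto
  then obtain t6 m6 out6 where
    6: "exec translate (m5, out) t6 (m6, out6)" "t6 \<le> 100 * (length outp + 1)" "same {11, 16, 17} m5 m6"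
      "out6 = out @ concat (map print_equation (map (rename_equation (old v)) tss))"
    unfolding runs_def p(3) by blast
  have len: "length outp \<le> F" using exec_length_output[OF p(1)] p(2) by simp
  have s6: "same (- {0, 1, 2, 10}) m m6" using 6(3) s5 by (auto simp: same_def)
  have "runs (greedy 8 (Const 0)) m6 out6 (\<lambda>t m' out'. t \<le> 400 * (n + L + 1) \<and> out' = out6 \<and>
    same {11, 12, 15, 8} m6 m' \<and> (\<exists>J. maximal J \<and> 0 \<in> J \<and> (\<forall>j<n. m' 8 (int j) = of_bool (j \<in> J))))"
    by (rule runs_greedy) (use Gs[OF s6] v in auto)
  then obtain t7 m7 J where
    7: "exec (greedy 8 (Const 0)) (m6, out6) t7 (m7, out6)" "t7 \<le> 400 * (n + L + 1)"
      "same {11, 12, 15, 8} m6 m7" "maximal J" "0 \<in> J" "\<forall>j<n. m7 8 (int j) = of_bool (j \<in> J)"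
    unfolding runs_def by blast
  have s7: "same (- {0, 1, 2, 10}) m m7" using 7(3) s6 by (auto simp: same_def)
  have "runs (greedy 9 (reg 10)) m7 out6 (\<lambda>t m' out'. t \<le> 400 * (n + L + 1) \<and> out' = out6 \<and>
    same {11, 12, 15, 9} m7 m' \<and> (\<exists>I. maximal I \<and> v \<in> I \<and> (\<forall>j<n. m' 9 (int j) = of_bool (j \<in> I))))"
    by (rule runs_greedy) (use Gs[OF s7] v in \<open>auto simp: same_def\<close>)
  then obtain t8 m8 I where
    8: "exec (greedy 9 (reg 10)) (m7, out6) t8 (m8, out6)" "t8 \<le> 400 * (n + L + 1)"
      "same {11, 12, 15, 9} m7 m8" "maximal I" "v \<in> I" "\<forall>j<n. m8 9 (int j) = of_bool (j \<in> I)"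
    unfolding runs_def by blast
  have s8: "same (- {0, 1, 2, 10}) m m8" using 8(3) s7 by (auto simp: same_def)
  have "\<forall>j<n. m8 8 (int j) = of_bool (j \<in> J)" using 7(6) 8(3) by (auto simp: same_def)
  moreover have "m8 0 0 = int n" "m8 10 0 = int v" using Gs[OF s8] by (auto simp: graph_mem_def)
  ultimately have "runs (Cond (reg 10) print_diff Skip) m8 out6 (\<lambda>t m' out'.
    t \<le> 100 * (n + 1) + 4 \<and> same {11} m8 m' \<and>
    out' = out6 @ (if v > 0 then print_equation (indicator_diff n I J) else []))"
    using runs_print_diff[of m8 n I J out6] 8(6)
    by (cases "v > 0") (auto simp: same_def elim!: runs_mono)
  then obtain t9 m9 out9 where
    9: "exec (Cond (reg 10) print_diff Skip) (m8, out6) t9 (m9, out9)" "t9 \<le> 100 * (n + 1) + 4"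
      "same {11} m8 m9" "out9 = out6 @ (if v > 0 then print_equation (indicator_diff n I J) else [])"
    unfolding runs_def by blast
  have s9: "same (- {0, 1, 2, 10}) m m9" using 9(3) s8 by (auto simp: same_def)
  let ?tss = "map (rename_equation (old v)) tss @ (if v > 0 then [indicator_diff n I J] else [])"
  have "out9 = out @ concat (map print_equation ?tss)" using 6(4) 9(4) by simp
  moreover have "block C v ?tss"
    by (rule block_append) (use v C p 7 8 in auto)
  moreover have "length ?tss \<le> K + of_bool (v > 0)" using p(7) by simp
  moreover have "exec (vertex_prog p) (m, out)
      (t1 + (t2 + (t3 + (3 + (t5 + (t6 + (t7 + (t8 + t9)))))))) (m9, out9)"
    unfolding vertex_prog_def by (intro exec.Seq) (fact 1 2 3 4 5 6 7 8 9)+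
  moreover have "t1 + (t2 + (t3 + (3 + (t5 + (t6 + (t7 + (t8 + t9))))))) \<le> 2000 * (n + L + 1) + 200 * F"
    \<comment> \<open>The coefficient of \<open>F\<close> is 9 for the simulation plus 100 for
      translating at most \<open>F\<close> printed numbers; the remaining phases add up to less than
      \<open>2000 * (n + L + 1)\<close>.\<close>
    using 1(2) 2(2) 3(2) 5(2) p(2) 6(2) len 7(2) 8(2) 9(2) by simp
  ultimately show ?thesis unfolding runs_def using s9 by blast
qed

text \<open>Well-coveredness passes to each subgraph and equates the two sampled sets of each block;
  conversely, the sampled sets are the witnesses for \<open>well_coveredI\<close> with
  \<open>u = vs ! 0\<close>.\<close>

lemma well_covering_blocks:
  assumes n: "n > 0" and B: "\<And>v. v < n \<Longrightarrow> block C v (B v)"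
  shows "solves (concat (map B [0..<n])) w \<longleftrightarrow> well_covered_weighting G w"
proof -
  have "solves (concat (map B [0..<n])) w \<longleftrightarrow> (\<forall>v<n. solves (B v) w)"
    by (auto simp: solves_def)
  also have "\<dots> \<longleftrightarrow> well_covered_weighting G w"
  proof
    assume w: "well_covered_weighting G w"
    show "\<forall>v<n. solves (B v) w"
    proof (intro allI impI)
      fix v assume v: "v < n"
      from B[OF v] obtain I J where
        "maximal_independent_set G I" "maximal_independent_set G J"
        "solves (B v) w \<longleftrightarrow>
          well_covered_weighting (subgraph v) w \<and> (v > 0 \<longrightarrow> sum w I = sum w J)"
        unfolding block_def by blast
      with well_covered_delete[OF simple _ w] well_coveredD[OF w] nth_verts[OF v]
      show "solves (B v) w" by iprover
    qed
  next
    assume w: "\<forall>v<n. solves (B v) w"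
    have vert: "\<exists>v<n. x = vs ! v" if "x \<in> verts G" for x using that verts_eq by auto
    show "well_covered_weighting G w"
    proof (rule well_coveredI[OF simple nth_verts[OF n]])
      fix x assume "x \<in> verts G"
      then obtain v where v: "v < n" "x = vs ! v" using vert by blast
      with w B[OF v(1)] show "well_covered_weighting (delete_verts G (closed_nbhd G x)) w"
        unfolding block_def by blast
    next
      fix x assume "x \<in> verts G" and x: "x \<noteq> vs ! 0"
      then obtain v where v: "v < n" "x = vs ! v" using vert by blast
      then have "v > 0" using x by (cases v) auto
      with v w B[OF v(1)] show "\<exists>I J. maximal_independent_set G I \<and> x \<in> I \<and>
          maximal_independent_set G J \<and> vs ! 0 \<in> J \<and> sum w I = sum w J"
        unfolding block_def by blast
    qed
  qed
  finally show ?thesis .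
qed

text \<open>Block 0 lacks the extra equation. Writing \<open>+ 1\<close> on the left avoids
  truncated subtraction.\<close>

lemma length_blocks:
  assumes "\<And>v. v < i \<Longrightarrow> length (B v) \<le> K + of_bool (v > 0)" "i > 0"
  shows "length (concat (map B [0..<i])) + 1 \<le> i * K + i"
  using assms
proof (induction i)
  case (Suc i)
  have "length (B i) \<le> K + of_bool (i > 0)" using Suc.prems by simp
  moreover have "i > 0 \<Longrightarrow> length (concat (map B [0..<i])) + 1 \<le> i * K + i" using Suc by simp
  ultimately show ?case by (cases "i > 0") auto
qed simp

text \<open>The 23 is the loop overhead 20 of \<open>runs_For\<close> plus the costs 1 and 2 of its
  two bounds.\<close>

lemma runs_main_prog:
  assumes C: "{-1, 0, 1} \<subseteq> C" and G: "graph_mem m" and n: "n > 0"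
    and p: "\<And>v. v < n \<Longrightarrow> solver C p F K v"
  shows "runs (main_prog p) m [] (\<lambda>t m' out. t \<le> n * (2000 * (n + L + 1) + 200 * F) + (n + 1) * 23 \<and>
    (\<exists>S. prints_system vs out S \<and> well_covering_system G S \<and> coefficients_in C G S \<and>
      length S + 1 \<le> n * K + n))"
proof -
  let ?I = "\<lambda>i m' out. same (- {0, 1, 2}) m m' \<and> (\<exists>B.
    (\<forall>v<i. block C v (B v) \<and> length (B v) \<le> K + of_bool (v > 0)) \<and>
    out = concat (map print_equation (concat (map B [0..<i]))))"
  have gm: "graph_mem m'" if "same (- {0, 1, 2}) m m'" for m'
    using graph_mem_same[OF that] G by simp
  have "runs (For 10 (Const 0) (reg 0) (vertex_prog p)) m []
    (\<lambda>t m' out'. t \<le> (\<Sum>i<n. 2000 * (n + L + 1) + 200 * F) +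
      (n + 1) * (expr_cost (Const 0) + expr_cost (reg 0) + 20) \<and> ?I n m' out')"
  proof (rule runs_For[where a = 0 and Inv = ?I])
    fix i m' out assume i: "i < n" and I: "?I i m' out" and r: "m' 10 0 = 0 + int i"
    then obtain B where B: "\<forall>v<i. block C v (B v) \<and> length (B v) \<le> K + of_bool (v > 0)"
      "out = concat (map print_equation (concat (map B [0..<i])))" by blast
    have gm': "graph_mem m'" using gm I by blast
    have r': "m' 10 0 = int i" using r by simp
    show "runs (vertex_prog p) m' out (\<lambda>t m'' out'. t \<le> 2000 * (n + L + 1) + 200 * F \<and>
      m'' 10 0 = 0 + int i \<and> ?I (Suc i) (m''(10 := (m'' 10)(0 := 0 + int i + 1))) out')"
    proof (rule runs_mono[OF runs_vertex_prog[of C m' i p F K out, OF C gm' r' i p[OF i]]], elim conjE exE)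
      fix t m'' out' tss
      assume *: "t \<le> 2000 * (n + L + 1) + 200 * F" "same (- {0, 1, 2, 10}) m' m''"
        "out' = out @ concat (map print_equation tss)" "block C i tss"
        "length tss \<le> K + of_bool (i > 0)"
      have "m'' 10 0 = 0 + int i" using *(2) r by (simp add: same_def)
      moreover have "same (- {0, 1, 2}) m (m''(10 := (m'' 10)(0 := 0 + int i + 1)))"
        using I *(2) by (auto simp: same_def)
      moreover have "\<forall>v<Suc i. block C v ((B(i := tss)) v) \<and>
          length ((B(i := tss)) v) \<le> K + of_bool (v > 0)"
        using B(1) * by (auto simp: less_Suc_eq)
      moreover have "map (B(i := tss)) [0..<i] = map B [0..<i]" by simp
      then have "out' = concat (map print_equation (concat (map (B(i := tss)) [0..<Suc i])))"
        using B(2) *(3) by simp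
      ultimately show "t \<le> 2000 * (n + L + 1) + 200 * F \<and>
        m'' 10 0 = 0 + int i \<and> ?I (Suc i) (m''(10 := (m'' 10)(0 := 0 + int i + 1))) out'"
        using *(1) by blast
    qed
  next
    fix i m' out assume "?I i m' out"
    then show "eval_expr m' (reg 0) = 0 + int n" using gm by (auto simp: graph_mem_def)
  qed (auto simp: same_def)
  then show ?thesis
    unfolding main_prog_def
  proof (rule runs_mono, elim conjE exE)
    fix t m' out B
    assume t: "t \<le> (\<Sum>i<n. 2000 * (n + L + 1) + 200 * F) +
      (n + 1) * (expr_cost (Const 0) + expr_cost (reg 0) + 20)"
      and B: "\<forall>v<n. block C v (B v) \<and> length (B v) \<le> K + of_bool (v > 0)"
      and out: "out = concat (map print_equation (concat (map B [0..<n])))"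
    let ?tss = "concat (map B [0..<n])"
    let ?S = "map (equation_coeff vs) ?tss"
    have ts: "valid_equation n ts" "\<forall>u\<in>verts G. equation_coeff vs ts u \<in> C" if mem: "ts \<in> set ?tss" for ts
    proof -
      obtain v where "v < n" "ts \<in> set (B v)" using mem by auto
      then show "valid_equation n ts" "\<forall>u\<in>verts G. equation_coeff vs ts u \<in> C"
        using B unfolding block_def by blast+
    qed
    have "prints_system vs out ?S"
      unfolding prints_system_def using out ts(1) enumeration(3) by (intro exI[of _ ?tss]) simp
    moreover have "coefficients_in C G ?S"
      unfolding coefficients_in_def using ts(2) unfolding set_map by blast
    moreover have "well_covering_system G ?S"
      unfolding well_covering_system_def
      using well_covering_blocks[OF n, of C B] B by (simp add: solves_def)
    moreover have "length ?S + 1 \<le> n * K + n"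
      using length_blocks[of n B K] B n by simp
    ultimately show "t \<le> n * (2000 * (n + L + 1) + 200 * F) + (n + 1) * 23 \<and>
      (\<exists>S. prints_system vs out S \<and> well_covering_system G S \<and> coefficients_in C G S \<and>
        length S + 1 \<le> n * K + n)"
      using t by (intro conjI exI[of _ ?S]) simp_all
  qed
qed

end

section \<open>Monotonicity of the graph parameters and the final bounds\<close>

lemma card_delete_le:
  assumes "finite_simple_graph G"
  shows "card (edges (delete_verts G X)) \<le> card (edges G)"
    and "card (verts (delete_verts G X)) \<le> card (verts G)"
proof -
  have "edges G \<subseteq> Pow (verts G)" using assms by (auto simp: finite_simple_graph_def)
  then have "finite (edges G)" "finite (verts G)"
    using assms finite_subset by (auto simp: finite_simple_graph_def)
  then show "card (edges (delete_verts G X)) \<le> card (edges G)"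
    "card (verts (delete_verts G X)) \<le> card (verts G)"
    by (auto simp: delete_verts_def intro!: card_mono)
qed

lemma graph_in_memory_listed:
  assumes "finite_simple_graph G" "graph_in_memory G vs m"
  obtains As where "listed_graph G vs As" "adjacency.graph_mem As m"
proof -
  from assms(2) obtain As where As: "adjacency_lists G vs As" "m 0 0 = int (length vs)"
    "\<forall>i\<le>length vs. m 1 (int i) = int (length (concat (take i As)))"
    "\<forall>k<length (concat As). m 2 (int k) = int (concat As ! k)"
    unfolding graph_in_memory_def by blast
  interpret listed_graph G vs As using assms(1) As(1) by unfold_locales
  have "graph_mem m" using As enumeration(3) by (simp add: graph_mem_def off_def)
  then show ?thesis using that listed_graph_axioms by blast
qed

text \<open>For a graph without vertices the bounds would be 0 steps and -1 equations, which no
  program and no system can meet; hence the restriction to nonempty vertex sets.\<close>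

theorem theorem5p3:
  fixes \<G> \<G>' :: "'a graph set"
    and f g :: "real \<Rightarrow> real \<Rightarrow> real"
    and C :: "real set"
  assumes "\<forall>G\<in>\<G>. finite_simple_graph G"
    and "\<forall>G\<in>\<G>'. finite_simple_graph G"
    and "\<forall>G\<in>\<G>. \<forall>v\<in>verts G. delete_verts G (closed_nbhd G v) \<in> \<G>'"
    and "nondecreasing_nonneg f"
    and "nondecreasing_nonneg g"
    and "C = \<rat> \<or> C = \<int> \<or> C = {-1, 0, 1}"
    and "well_covering_computable C \<G>' f g"
  shows "\<exists>c\<ge>0. well_covering_computable C {G \<in> \<G>. verts G \<noteq> {}}
    (\<lambda>n m. c * (n * (n + m + f n m))) (\<lambda>n m. n * g n m + n - 1)"
proof -
  have C: "{-1, 0, 1} \<subseteq> C" using assms(6) by auto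
  from assms(7) obtain p where p: "\<And>G vs mem. G \<in> \<G>' \<Longrightarrow> graph_in_memory G vs mem \<Longrightarrow>
    \<exists>t mem' out S. exec p (mem, []) t (mem', out) \<and>
      real t \<le> f (real (card (verts G))) (real (card (edges G))) \<and> prints_system vs out S \<and>
      well_covering_system G S \<and> coefficients_in C G S \<and>
      real (length S) \<le> g (real (card (verts G))) (real (card (edges G)))"
    unfolding well_covering_computable_def by blast
  have mono: "h (real a) (real b) \<le> h (real a') (real b')" if "nondecreasing_nonneg h" "a \<le> a'" "b \<le> b'"
    for h :: "real \<Rightarrow> real \<Rightarrow> real" and a b a' b' :: nat
    using that unfolding nondecreasing_nonneg_def by simp
  have main: "\<exists>t mem' out S. exec (main_prog p) (mem, []) t (mem', out) \<and>
      real t \<le> 10000 * (real (card (verts G)) * (real (card (verts G)) + real (card (edges G)) +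
        f (real (card (verts G))) (real (card (edges G))))) \<and>
      prints_system vs out S \<and> well_covering_system G S \<and> coefficients_in C G S \<and>
      real (length S) \<le> real (card (verts G)) * g (real (card (verts G))) (real (card (edges G))) +
        real (card (verts G)) - 1"
    if G: "G \<in> \<G>" "verts G \<noteq> {}" and mem: "graph_in_memory G vs mem" for G vs mem
  proof -
    have simple: "finite_simple_graph G" using assms(1) G by blast
    from graph_in_memory_listed[OF this mem] obtain As where
      As: "listed_graph G vs As" "adjacency.graph_mem As mem" .
    interpret listed_graph G vs As by fact
    define m where "m = card (edges G)"
    have card: "card (verts G) = n" using enumeration distinct_card by metis
    have n: "n > 0" using G(2) card finite_verts by (metis card_gt_0_iff)
    \<comment> \<open>Step counts and sizes are natural numbers, so rounding the bounds down loses
      nothing.\<close>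
    define F where "F = nat \<lfloor>f n m\<rfloor>"
    define K where "K = nat \<lfloor>g n m\<rfloor>"
    have nonneg: "f n m \<ge> 0" "g n m \<ge> 0"
      using assms(4,5) unfolding nondecreasing_nonneg_def by simp_all
    then have FK: "real F \<le> f n m" "real K \<le> g n m" by (simp_all add: F_def K_def)
    have "solver C p F K v" if v: "v < n" for v
      unfolding solver_def
    proof (intro allI impI)
      fix mem' assume mem': "graph_in_memory (subgraph v) (sub_vs v) mem'"
      have "subgraph v \<in> \<G>'" using assms(3) G(1) nth_verts[OF v] by blast
      from p[OF this mem'] obtain t mem'' out S where
        S: "exec p (mem', []) t (mem'', out)"
          "real t \<le> f (real (card (verts (subgraph v)))) (real (card (edges (subgraph v))))"
          "prints_system (sub_vs v) out S" "well_covering_system (subgraph v) S"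
          "coefficients_in C (subgraph v) S"
          "real (length S) \<le> g (real (card (verts (subgraph v)))) (real (card (edges (subgraph v))))"
        by blast
      note le = card_delete_le[OF simple, of "closed_nbhd G (vs ! v)", folded m_def, unfolded card]
      have "real t \<le> f n m" "real (length S) \<le> g n m"
        using S(2,6) mono[OF assms(4) le(2,1)] mono[OF assms(5) le(2,1)] by linarith+
      then have "t \<le> F" "length S \<le> K" by (simp_all add: F_def K_def le_nat_floor)
      with S show "\<exists>t mem'' out S. exec p (mem', []) t (mem'', out) \<and> t \<le> F \<and>
        prints_system (sub_vs v) out S \<and> well_covering_system (subgraph v) S \<and>
        coefficients_in C (subgraph v) S \<and> length S \<le> K" by blast
    qed
    from runs_main_prog[OF C As(2) n this, unfolded runs_def] obtain t mem' out S where
      S: "exec (main_prog p) (mem, []) t (mem', out)"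
        "t \<le> n * (2000 * (n + L + 1) + 200 * F) + (n + 1) * 23"
        "prints_system vs out S" "well_covering_system G S" "coefficients_in C G S"
        "length S + 1 \<le> n * K + n" by blast
    have "t \<le> 10000 * (n * (n + m + F))"
    proof -
      have L: "L \<le> 2 * m" using length_concat_le by (simp add: m_def)
      \<comment> \<open>Since \<open>n \<ge> 1\<close>, every additive 1 is replaced by
        \<open>n\<close> and 23 by \<open>23 * n\<close>, which leaves multiples of the three
        products of \<open>n\<close> with \<open>n\<close>, \<open>m\<close> and
        \<open>F\<close>.\<close>
      have "n * (2000 * (n + L + 1) + 200 * F) + (n + 1) * 23
          \<le> n * (2000 * (n + 2 * m + n) + 200 * F) + (n + n) * (23 * n)"
        using L n by (intro add_mono mult_mono) (auto simp: Suc_le_eq)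
      also have "\<dots> \<le> 10000 * (n * (n + m + F))" by (simp add: algebra_simps)
      finally show ?thesis using S(2) by simp
    qed
    then have "real t \<le> real (10000 * (n * (n + m + F)))" by (rule of_nat_mono)
    also have "\<dots> = 10000 * (real n * (real n + real m + real F))" by simp
    also have "\<dots> \<le> 10000 * (real n * (real n + real m + f n m))"
      using FK by (intro mult_left_mono) auto
    finally have t: "real t \<le> 10000 * (real n * (real n + real m + f n m))" .
    have "real (length S) + 1 \<le> real n * real K + real n"
      using S(6) by (metis of_nat_1 of_nat_add of_nat_le_iff of_nat_mult)
    also have "\<dots> \<le> real n * g n m + real n"
      using FK by (intro add_right_mono mult_left_mono) auto
    finally have len: "real (length S) \<le> real n * g n m + real n - 1" by simp
    show ?thesis
      using S(1,3,4,5) t len unfolding card m_def[symmetric] by blast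
  qed
  show ?thesis
    unfolding well_covering_computable_def
    by (rule exI[of _ 10000], rule conjI, simp, rule exI[of _ "main_prog p"]) (use main in blast)
qed

end
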